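(* Let $F_1(t,u)$ be the generating function of intervals in the posets $(\mathcal{M}_n,\leq_{\mathcal{M}})$, \[ F_1(t,u) = \sum_{n\ge 1} t^n \sum_{P,Q\in\mathcal{M}_n,\ P\leq_{\mathcal{M}} Q} u^{|P|_D}, \] where $|P|_D$ is the number of diagonal steps of $P$ (which equals that of $Q$). Then $F_1(t,u)$ is algebraic. More precisely, let $X$ be the formal power series in $t$ with coefficients polynomial in $u$ that satisfies \[ u^2 t^2 X^5 - t^2 (1 + u^2) X^4 - 2 u t X^3 + 2 u t X^2 + X - 1 = 0. \] Then \[ F_1(t,u) = \frac{u^2 t^2 X^4 - t (u^2 t + u t^2 + u + 2t) X^3 + (1 + u t + t^2) X - 1}{t^2 X (u t X^2 - 1)}. \]
   Context: A Motzkin path is a non-empty lattice path in $\mathbb{Z}^2$ starting at $(0,0)$, ending on the diagonal $y=x$, staying weakly above the diagonal, with steps $N=(0,1)$, $E=(1,0)$, $D=(1,1)$. The size of a path is its number of steps, and $\mathcal{M}_n$ is the set of Motzkin paths of size $n$. Order: a valley of a path $P$ is a lattice point $v$ on $P$ preceded by an $E$ step and followed by an $N$ or $D$ step. Given a valley $v$ of a Motzkin path $P$, let $w$ be the next lattice point on $P$ after $v$ with the same horizontal distance to the diagonal as $v$ (the horizontal distance of $(a,b)$ is $b-a$). Exchanging the sub-path of $P$ between $v$ and $w$ with the $E$ step just before $v$ gives a Motzkin path $Q$; one says $Q$ covers $P$. The order $\leq_{\mathcal{M}}$ on $\mathcal{M}_n$ is the reflexive transitive closure of this covering relation. Intervals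 are identified with pairs $(P,Q)$ with $P\leq_{\mathcal{M}}Q$. "Algebraic" means algebraic over $\mathbb{Q}(t,u)$. There is exactly one formal power series $X$ in $t$ with coefficients in $\mathbb{Q}[u]$ satisfying the displayed equation; it has constant term $1$. *)

theory Defs
  imports
    "HOL-Library.Product_Plus"
    "HOL-Computational_Algebra.Computational_Algebra"
begin

datatype step = N | E | D

fun step_vec :: "step \<Rightarrow> int \<times> int" where
  "step_vec N = (0, 1)"
| "step_vec E = (1, 0)"
| "step_vec D = (1, 1)"

text \<open>
  A path is the list of its steps. Its lattice points are pairwise distinct and are addressed by
  the number of steps preceding them.
\<close>
definition point :: "step list \<Rightarrow> nat \<Rightarrow> int \<times> int" where
  "point P i = sum_list (map step_vec (take i P))"

definition hdist :: "int \<times> int \<Rightarrow> int" where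
  "hdist v = snd v - fst v"

definition motzkin_path :: "step list \<Rightarrow> bool" where
  "motzkin_path P \<longleftrightarrow>
     P \<noteq> [] \<and>
     fst (point P (length P)) = snd (point P (length P)) \<and>
     (\<forall>i\<le>length P. fst (point P i) \<le> snd (point P i))"

definition motzkin_paths :: "nat \<Rightarrow> step list set" where
  "motzkin_paths n = {P. motzkin_path P \<and> length P = n}"

definition valley :: "step list \<Rightarrow> nat \<Rightarrow> bool" where
  "valley P i \<longleftrightarrow> 0 < i \<and> i < length P \<and> P ! (i - 1) = E \<and> P ! i \<in> {N, D}"

definition next_same_hdist :: "step list \<Rightarrow> nat \<Rightarrow> nat \<Rightarrow> bool" where
  "next_same_hdist P i j \<longleftrightarrow>
     i < j \<and> j \<le> length P \<and> hdist (point P j) = hdist (point P i) \<and>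
     (\<forall>k. i < k \<and> k < j \<longrightarrow> hdist (point P k) \<noteq> hdist (point P i))"

text \<open>
  \<open>motzkin_covers P Q\<close> means that \<open>Q\<close> covers \<open>P\<close>: the step \<open>E\<close> at position \<open>i - 1\<close> and the
  sub-path formed by the steps at positions \<open>i, \<dots>, j - 1\<close> are exchanged.
\<close>
definition motzkin_covers :: "step list \<Rightarrow> step list \<Rightarrow> bool" where
  "motzkin_covers P Q \<longleftrightarrow>
     motzkin_path P \<and>
     (\<exists>i j. valley P i \<and> next_same_hdist P i j \<and>
        Q = take (i - 1) P @ drop i (take j P) @ [E] @ drop j P)"

definition motzkin_le :: "step list \<Rightarrow> step list \<Rightarrow> bool" where
  "motzkin_le = motzkin_covers\<^sup>*\<^sup>*"

definition diag_steps :: "step list \<Rightarrow> nat" where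
  "diag_steps P = count_list P D"

definition motzkin_intervals :: "nat \<Rightarrow> (step list \<times> step list) set" where
  "motzkin_intervals n =
     {(P, Q). P \<in> motzkin_paths n \<and> Q \<in> motzkin_paths n \<and> motzkin_le P Q}"

text \<open>Power series in the variable \<open>t\<close> whose coefficients are polynomials in the variable \<open>u\<close>.\<close>

type_synonym series = "rat poly fps"

definition t_var :: series where
  "t_var = fps_X"

definition u_var :: series where
  "u_var = fps_const [:0, 1:]"

definition F1 :: series where
  "F1 = Abs_fps (\<lambda>n. if n \<ge> 1
          then \<Sum>(P, Q) \<in> motzkin_intervals n. [:0, 1:] ^ diag_steps P else 0)"

definition X_equation :: "series \<Rightarrow> bool" where
  "X_equation X \<longleftrightarrow> (let t = t_var; u = u_var in
     u^2 * t^2 * X^5 - t^2 * (1 + u^2) * X^4 - 2 * u * t * X^3 + 2 * u * t * X^2 + X - 1 = 0)"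

text \<open>
  Quotients of series are formed in the field of Laurent series in \<open>t\<close> over \<open>\<rat>(u)\<close>. The series ring
  embeds into this field coefficientwise, and \<open>\<rat>(t, u)\<close> is the subfield of quotients of polynomials
  in \<open>t\<close> and \<open>u\<close>.
\<close>
definition to_laurent :: "series \<Rightarrow> rat poly fract fls" where
  "to_laurent f = fps_to_fls (Abs_fps (\<lambda>n. to_fract (fps_nth f n)))"

definition Q_t_u :: "rat poly fract fls set" where
  "Q_t_u = {to_laurent (fps_of_poly a) / to_laurent (fps_of_poly b) | a b. b \<noteq> 0}"

definition algebraic_over :: "'a::field set \<Rightarrow> 'a \<Rightarrow> bool" where
  "algebraic_over K x \<longleftrightarrow> (\<exists>p. p \<noteq> 0 \<and> (\<forall>i. coeff p i \<in> K) \<and> poly p x = 0)"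

end

theory Submission
  imports Defs
begin

text \<open>
  In an interval \<open>P \<le> Q\<close> with \<open>Q = D S\<close> one has \<open>P = D R\<close> with \<open>R \<le> S\<close>, and if \<open>Q = N Q' E S\<close> is the
  first-return decomposition then \<open>P = N A E B R\<close> with \<open>A B \<le> Q'\<close> and \<open>R \<le> S\<close>; conversely all such
  pairs are intervals. Counting contacts of the lower path by a catalytic variable \<open>x\<close> gives
  \<open>(x - 1)(F(x) - 1) = x F(x) (t\<^sup>2 (x F(x) - F(1)) + u t (x - 1))\<close>, where \<open>F(1) = 1 + F1\<close>.

  The discriminant of this quadratic in \<open>F(x)\<close> has a double root at \<open>x = 1 + w\<^sup>2\<close>, where \<open>w\<close> is the
  series fixed by \<open>w = t x F(x)\<close>. Eliminating \<open>F(x)\<close> yields \<open>w = t (1 + w\<^sup>2)\<^sup>2 (1 + u w)\<close> and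
  \<open>t (1 + F1) = w - w\<^sup>3 - u w\<^sup>4\<close>. Here \<open>X = 1 + w\<^sup>2\<close>, as the equation of \<open>X\<close> says that
  \<open>(X - 1)(1 - u t X\<^sup>2)\<^sup>2 = t\<^sup>2 X\<^sup>4\<close>. Finally \<open>F1\<close> lies in the finite extension of \<open>\<rat>(t, u)\<close>
  generated by \<open>w\<close>.
\<close>

section \<open>Motzkin paths and the first-return form of the order\<close>

text \<open>
  \<open>mpath h P\<close>: the step list \<open>P\<close>, started at height \<open>h\<close> above the diagonal, stays weakly above the
  diagonal and ends on it. In contrast to \<open>motzkin_path\<close>, the empty path is allowed.
\<close>
fun mpath :: "nat \<Rightarrow> step list \<Rightarrow> bool" where
  "mpath h [] \<longleftrightarrow> h = 0"
| "mpath h (N # P) \<longleftrightarrow> mpath (Suc h) P"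
| "mpath h (D # P) \<longleftrightarrow> mpath h P"
| "mpath 0 (E # P) \<longleftrightarrow> False"
| "mpath (Suc h) (E # P) \<longleftrightarrow> mpath h P"

fun height :: "step list \<Rightarrow> int" where
  "height [] = 0"
| "height (N # P) = height P + 1"
| "height (D # P) = height P"
| "height (E # P) = height P - 1"

lemma height_append [simp]: "height (A @ B) = height A + height B"
  by (induction A rule: height.induct) auto

lemma mpath_height: "mpath h P \<Longrightarrow> height P = - int h"
  by (induction h P rule: mpath.induct) auto

lemma mpath_unique_height: "mpath h P \<Longrightarrow> mpath k P \<Longrightarrow> h = k"
  using mpath_height[of h P] mpath_height[of k P] by simp

lemma mpath_prefix_height: "mpath h (A @ B) \<Longrightarrow> 0 \<le> int h + height A"
  by (induction h A rule: mpath.induct) auto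

lemma mpath_iff_height:
  "mpath h P \<longleftrightarrow> height P = - int h \<and> (\<forall>i\<le>length P. 0 \<le> int h + height (take i P))"
proof
  assume "mpath h P"
  then show "height P = - int h \<and> (\<forall>i\<le>length P. 0 \<le> int h + height (take i P))"
    by (metis append_take_drop_id mpath_height mpath_prefix_height)
next
  show "height P = - int h \<and> (\<forall>i\<le>length P. 0 \<le> int h + height (take i P)) \<Longrightarrow> mpath h P"
  proof (induction h P rule: mpath.induct)
    case (2 h P)
    have "0 \<le> int (Suc h) + height (take i P)" if "i \<le> length P" for i
      using 2(2) that by (auto dest: spec[of _ "Suc i"])
    with 2 show ?case by auto
  next
    case (3 h P)
    have "0 \<le> int h + height (take i P)" if "i \<le> length P" for i
      using 3(2) that by (auto dest: spec[of _ "Suc i"])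
    with 3 show ?case by auto
  next
    case (4 P)
    then have "0 \<le> int 0 + height (take 1 (E # P))" by (metis One_nat_def Suc_le_eq length_greater_0_conv list.discI)
    then show ?case by simp
  next
    case (5 h P)
    have "0 \<le> int h + height (take i P)" if "i \<le> length P" for i
      using 5(2) that by (auto dest: spec[of _ "Suc i"])
    with 5 show ?case by auto
  qed auto
qed

lemma mpath_append: "mpath 0 A \<Longrightarrow> mpath h (A @ B) \<longleftrightarrow> mpath h B"
proof -
  have "mpath k A \<Longrightarrow> mpath (h + k) (A @ B) \<longleftrightarrow> mpath h B" for k
    by (induction k A rule: mpath.induct) auto
  from this[of 0] show "mpath 0 A \<Longrightarrow> ?thesis" by simp
qed

lemma mpath_append_left: "mpath h (A @ B) \<Longrightarrow> mpath 0 B \<Longrightarrow> mpath h A"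
  by (induction h A rule: mpath.induct) (auto dest: mpath_unique_height)

text \<open>Postponing the \<open>E\<close> raises the heights inside \<open>B\<close> by one and
  leaves the others unchanged.\<close>

lemma mpath_exchange:
  assumes "mpath 0 B" "mpath h (A @ E # B @ C)"
  shows "mpath h (A @ B @ E # C)"
  using assms(2)
proof (induction h A rule: mpath.induct)
  case (1 h)
  then show ?case using assms(1) by (cases h) (auto simp: mpath_append)
qed auto

text \<open>The cut is where the path first drops below its starting height. After an
  \<open>N\<close> step the induction hypothesis is used twice: to come back to the starting height,
  then to leave it downwards.\<close>

lemma first_return:
  "mpath (Suc h) P \<Longrightarrow> \<exists>A B. P = A @ E # B \<and> mpath 0 A \<and> mpath h B"
proof (induction "length P" arbitrary: h P rule: less_induct)
  case less
  show ?case
  proof (cases P)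
    case Nil
    with less.prems show ?thesis by simp
  next
    case (Cons s P')
    show ?thesis
    proof (cases s)
      case N
      then obtain A B where AB: "P' = A @ E # B" "mpath 0 A" "mpath (Suc h) B"
        using less.hyps[of P' "Suc h"] less.prems Cons by auto
      then obtain A' B' where "B = A' @ E # B'" "mpath 0 A'" "mpath h B'"
        using less.hyps[of B h] Cons by auto
      with AB Cons N show ?thesis
        by (intro exI[of _ "N # A @ E # A'"] exI[of _ B']) (auto simp: mpath_append)
    next
      case E
      then show ?thesis using Cons less.prems by (intro exI[of _ "[]"] exI[of _ P']) auto
    next
      case D
      then obtain A B where "P' = A @ E # B" "mpath 0 A" "mpath h B"
        using less.hyps[of P' h] less.prems Cons by auto
      with D Cons show ?thesis by (intro exI[of _ "D # A"] exI[of _ B]) auto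
    qed
  qed
qed

text \<open>If the cuts differed, the longer of \<open>A\<close> and \<open>A'\<close> would begin
  with the shorter one followed by \<open>E\<close>, a step below its starting height.\<close>

lemma first_return_unique:
  assumes "mpath 0 A" "mpath 0 A'" "A @ E # B = A' @ E # B'"
  shows "A = A' \<and> B = B'"
proof -
  have *: "\<not> mpath 0 (L @ E # M)" if "mpath 0 L" for L M
    using that by (simp add: mpath_append)
  from assms(3) show ?thesis
    using assms(1,2) * by (auto simp: append_eq_append_conv2 Cons_eq_append_conv append_eq_Cons_conv)
qed

lemma mpath_induct [consumes 1, case_names Nil D N]:
  assumes "mpath 0 P"
    and "R []"
    and "\<And>P. mpath 0 P \<Longrightarrow> R P \<Longrightarrow> R (D # P)"
    and "\<And>A B. mpath 0 A \<Longrightarrow> mpath 0 B \<Longrightarrow> R A \<Longrightarrow> R B \<Longrightarrow> R (N # A @ E # B)"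
  shows "R P"
  using assms(1)
proof (induction "length P" arbitrary: P rule: less_induct)
  case less
  show ?case
  proof (cases P)
    case Nil
    then show ?thesis using assms(2) by simp
  next
    case (Cons s P')
    show ?thesis
    proof (cases s)
      case N
      then obtain A B where "P' = A @ E # B" "mpath 0 A" "mpath 0 B"
        using first_return[of 0 P'] less.prems Cons by auto
      with less.hyps[of A] less.hyps[of B] assms(4) Cons N show ?thesis by auto
    next
      case E
      then show ?thesis using Cons less.prems by simp
    next
      case D
      with less.hyps[of P'] less.prems assms(3) Cons show ?thesis by auto
    qed
  qed
qed

section \<open>Covers as exchanges of an \<open>E\<close> step with a prime block\<close>

lemma hdist_point: "hdist (point P i) = height (take i P)"
proof -
  have "hdist (sum_list (map step_vec Q)) = height Q" for Q
    by (induction Q rule: height.induct) (auto simp: hdist_def)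
  then show ?thesis by (simp add: point_def)
qed

lemma motzkin_path_iff: "motzkin_path P \<longleftrightarrow> P \<noteq> [] \<and> mpath 0 P"
proof -
  have "fst (point P i) = snd (point P i) \<longleftrightarrow> height (take i P) = 0" for i
    using hdist_point[of P i] by (auto simp: hdist_def)
  moreover have "fst (point P i) \<le> snd (point P i) \<longleftrightarrow> 0 \<le> height (take i P)" for i
    using hdist_point[of P i] by (auto simp: hdist_def)
  ultimately show ?thesis
    by (simp add: motzkin_path_def mpath_iff_height)
qed

text \<open>Non-empty paths that meet their starting height only at both ends: the blocks between a
  valley and the next point at the same distance from the diagonal.\<close>

definition prime_path :: "step list \<Rightarrow> bool" where
  "prime_path B \<longleftrightarrow> B = [D] \<or> (\<exists>M. mpath 0 M \<and> B = N # M @ [E])"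

lemma prime_path_mpath: "prime_path B \<Longrightarrow> mpath 0 B"
  by (auto simp: prime_path_def mpath_append)

definition exchange :: "step list \<Rightarrow> step list \<Rightarrow> bool" where
  "exchange P Q \<longleftrightarrow>
     (\<exists>A B C. prime_path B \<and> P = A @ E # B @ C \<and> Q = A @ B @ E # C)"

lemma next_same_hdist_prime_path:
  assumes "prime_path B" "P = A @ E # B @ C"
  shows "next_same_hdist P (Suc (length A)) (Suc (length A) + length B)"
proof -
  have "height B = 0" using mpath_height[OF prime_path_mpath[OF assms(1)]] by simp
  moreover have "height (take k P) \<noteq> height (take (Suc (length A)) P)"
    if k: "Suc (length A) < k" "k < Suc (length A) + length B" for k
  proof (cases "B = [D]")
    case True
    then show ?thesis using k by simp
  next
    case False
    then obtain M where M: "mpath 0 M" "B = N # M @ [E]"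
      using assms(1) by (auto simp: prime_path_def)
    obtain m where m: "k = Suc (Suc (length A)) + m" "m \<le> length M"
      using k M by (auto dest!: less_imp_Suc_add)
    have "0 \<le> height (take m M)"
      using mpath_prefix_height[of 0 "take m M" "drop m M"] M by simp
    then show ?thesis using m M assms(2) by simp
  qed
  moreover have "0 < length B" using assms(1) by (auto simp: prime_path_def)
  ultimately show ?thesis
    by (auto simp: next_same_hdist_def hdist_point assms(2))
qed

lemma next_same_hdist_unique:
  "next_same_hdist P i j \<Longrightarrow> next_same_hdist P i j' \<Longrightarrow> j = j'"
  unfolding next_same_hdist_def by (metis linorder_neqE_nat)

lemma motzkin_covers_iff: "motzkin_covers P Q \<longleftrightarrow> mpath 0 P \<and> exchange P Q"
proof
  assume "motzkin_covers P Q"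
  then obtain i j where P: "motzkin_path P" and v: "valley P i" and n: "next_same_hdist P i j"
    and Q: "Q = take (i - 1) P @ drop i (take j P) @ [E] @ drop j P"
    by (auto simp: motzkin_covers_def)
  define A where "A = take (i - 1) P"
  define R where "R = drop i P"
  have i: "i = Suc (length A)" using v by (auto simp: valley_def A_def)
  have P_eq: "P = A @ E # R"
    using v id_take_nth_drop[of "i - 1" P] by (auto simp: valley_def A_def R_def)
  have R: "R \<noteq> []" "hd R \<in> {N, D}"
    using v by (auto simp: valley_def R_def hd_drop_conv_nth)
  have mp: "mpath 0 P" using P by (simp add: motzkin_path_iff)
  \<comment> \<open>A suffix of a path is a path from the height where it starts; this is what
    \<open>first_return\<close> needs below when the block begins with \<open>N\<close>.\<close>
  have "\<exists>h. mpath h R"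
  proof -
    have "mpath k (A @ E # R) \<Longrightarrow> \<exists>h. mpath h R" for k
    proof (induction k A rule: mpath.induct)
      case (1 h)
      then show ?case by (cases h) auto
    qed auto
    then show ?thesis using mp P_eq by blast
  qed
  then obtain h where h: "mpath h R" by blast
  have "\<exists>B C. prime_path B \<and> R = B @ C"
  proof (cases "hd R = D")
    case True
    then have "prime_path [D] \<and> R = [D] @ tl R"
      using R by (metis append_Cons append_Nil list.collapse prime_path_def)
    then show ?thesis by blast
  next
    case False
    then have "R = N # tl R" using R by (metis empty_iff insert_iff list.collapse)
    moreover from this have "mpath (Suc h) (tl R)" using h by (metis mpath.simps(2))
    then obtain M C where "tl R = M @ E # C" "mpath 0 M" using first_return by blast
    ultimately have "prime_path (N # M @ [E]) \<and> R = (N # M @ [E]) @ C"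
      by (auto simp: prime_path_def)
    then show ?thesis by blast
  qed
  then obtain B C where BC: "prime_path B" "R = B @ C" by blast
  have "j = Suc (length A) + length B"
    using next_same_hdist_unique[OF n] next_same_hdist_prime_path[OF BC(1)] P_eq BC(2) i by blast
  then have "Q = A @ B @ E # C" using Q i P_eq BC by simp
  then show "mpath 0 P \<and> exchange P Q"
    using mp P_eq BC by (auto simp: exchange_def)
next
  assume "mpath 0 P \<and> exchange P Q"
  then obtain A B C where mp: "mpath 0 P" and B: "prime_path B" and P: "P = A @ E # B @ C"
    and Q: "Q = A @ B @ E # C"
    by (auto simp: exchange_def)
  have "motzkin_path P" using mp P by (simp add: motzkin_path_iff)
  moreover have "valley P (Suc (length A))"
    using B by (auto simp: valley_def P prime_path_def nth_append)
  moreover have "next_same_hdist P (Suc (length A)) (Suc (length A) + length B)"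
    using next_same_hdist_prime_path B P by blast
  moreover have "Q = take (Suc (length A) - 1) P @ drop (Suc (length A))
      (take (Suc (length A) + length B) P) @ [E] @ drop (Suc (length A) + length B) P"
    using P Q by simp
  ultimately show "motzkin_covers P Q" unfolding motzkin_covers_def by blast
qed

text \<open>
  The Motzkin order, read off the first-return decomposition \<open>N Q E S\<close> of the upper path: the point
  where the upper path first returns is also a contact of the lower path, which may have returned
  earlier, after \<open>N A E\<close>.
\<close>
inductive first_return_le :: "step list \<Rightarrow> step list \<Rightarrow> bool" where
  first_return_le_Nil: "first_return_le [] []"
| first_return_le_D: "first_return_le P Q \<Longrightarrow> first_return_le (D # P) (D # Q)"
| first_return_le_N: "mpath 0 A \<Longrightarrow> mpath 0 B \<Longrightarrow> first_return_le (A @ B) Q \<Longrightarrow> first_return_le R S \<Longrightarrow>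
    first_return_le (N # A @ E # B @ R) (N # Q @ E # S)"

lemma first_return_le_mpath: "first_return_le P Q \<Longrightarrow> mpath 0 P \<and> mpath 0 Q"
  by (induction rule: first_return_le.induct) (auto simp: mpath_append)

lemma first_return_le_length: "first_return_le P Q \<Longrightarrow> length P = length Q"
  by (induction rule: first_return_le.induct) auto

lemma first_return_le_count_D: "first_return_le P Q \<Longrightarrow> count_list P D = count_list Q D"
  by (induction rule: first_return_le.induct) auto

lemma first_return_le_refl: "mpath 0 P \<Longrightarrow> first_return_le P P"
proof (induction rule: mpath_induct)
  case (N A B)
  then show ?case using first_return_le_N[of A "[]" A B B] by simp
qed (auto intro: first_return_le.intros)

text \<open>
  Closure under a single covering step below. Heights rule out that the block \<open>B\<close> straddles one
  of the boundaries of the first-return decomposition.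
\<close>
lemma first_return_le_exchange:
  assumes "first_return_le P' Q" "P' = A @ B @ E # C" "mpath 0 B" "mpath 0 (A @ E # B @ C)"
  shows "first_return_le (A @ E # B @ C) Q"
  using assms
proof (induction arbitrary: A B C rule: first_return_le.induct)
  case first_return_le_Nil
  then show ?case by simp
next
  case (first_return_le_D P Q)
  then obtain A' where "A = D # A'" by (cases A) auto
  with first_return_le_D show ?case by (auto intro: first_return_le.first_return_le_D)
next
  case (first_return_le_N Pa Pb Q R S)
  note B = \<open>mpath 0 B\<close>
  obtain A' where A: "A = N # A'" using first_return_le_N.prems by (cases A) auto
  have eq: "Pa @ E # Pb @ R = A' @ B @ E # C" using first_return_le_N.prems A by simp
  have mp: "mpath (Suc 0) (A' @ E # B @ C)" using first_return_le_N.prems A by simp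
  obtain Pa0 Z where Z: "A' @ E # B @ C = Pa0 @ E # Z" "mpath 0 Pa0" "mpath 0 Z"
    using first_return[OF mp] by blast
  have R: "mpath 0 R" using first_return_le_N.hyps first_return_le_mpath by blast
  \<comment> \<open>The moved \<open>E\<close> is the first-return step of the path before the
    exchange, or comes after it, or before it.\<close>
  consider "A' = Pa0" "B @ C = Z"
    | A2 where "A' = Pa0 @ E # A2" "A2 @ E # B @ C = Z"
    | S' where "Pa0 = A' @ E # S'" "B @ C = S' @ E # Z"
    using Z(1) by (auto simp: append_eq_append_conv2 Cons_eq_append_conv append_eq_Cons_conv)
  then show ?case
  proof cases
    case 1
    \<comment> \<open>The exchange moved the first return behind \<open>B\<close>. Undoing it
      transfers \<open>B\<close> from inside the arch to the part after it, which
      \<open>first_return_le_N\<close> allows.\<close>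
    have "Pa = A' @ B \<and> Pb @ R = C"
      using first_return_unique[of Pa "A' @ B" "Pb @ R" C] first_return_le_N.hyps(1) B 1 Z(2) eq
      by (simp add: mpath_append)
    with 1 Z(2) B first_return_le_N.hyps first_return_le.first_return_le_N[of A' "B @ Pb" Q R S] A show ?thesis
      by (auto simp: mpath_append)
  next
    case 2
    have Pa: "Pa = Pa0" "Pb @ R = A2 @ B @ E # C"
      using first_return_unique[of Pa Pa0 "Pb @ R" "A2 @ B @ E # C"] first_return_le_N.hyps(1) 2 Z(2) eq
      by auto
    have m2: "mpath 0 (A2 @ E # B @ C)" using 2 Z(3) by simp
    consider C1 where "Pb = A2 @ B @ E # C1" "C = C1 @ R"
      | T where "A2 = Pb @ T" "R = T @ B @ E # C"
      | T T' where "Pb = A2 @ T" "B = T @ T'" "R = T' @ E # C"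
      using Pa(2) by (auto simp: append_eq_append_conv2 Cons_eq_append_conv append_eq_Cons_conv)
    then show ?thesis
    proof cases
      case (1 C1)
      have "mpath 0 (A2 @ E # B @ C1)"
        using m2 1 R mpath_append_left[of 0 "A2 @ E # B @ C1" R] by simp
      then have "first_return_le ((Pa @ A2) @ E # B @ C1) Q" and m3: "mpath 0 (A2 @ E # B @ C1)"
        using first_return_le_N.IH(1)[of "Pa @ A2" B C1] 1 B first_return_le_N.hyps(1) by (auto simp: mpath_append)
      then have "first_return_le (N # Pa @ E # (A2 @ E # B @ C1) @ R) (N # Q @ E # S)"
        using first_return_le.first_return_le_N[of Pa "A2 @ E # B @ C1" Q R S] first_return_le_N.hyps by simp
      then show ?thesis using A 1 2 Pa by simp
    next
      case (2 T)
      have "mpath 0 (T @ E # B @ C)"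
        using m2 2 first_return_le_N.hyps(2) by (simp add: mpath_append)
      then have "first_return_le (T @ E # B @ C) S" using first_return_le_N.IH(2)[of T B C] 2 B by simp
      then have "first_return_le (N # Pa @ E # Pb @ (T @ E # B @ C)) (N # Q @ E # S)"
        using first_return_le.first_return_le_N first_return_le_N.hyps by blast
      then show ?thesis using A 2 Pa \<open>A' = Pa0 @ E # A2\<close> by simp
    next
      case (3 T T')
      \<comment> \<open>Both parts of \<open>B\<close> have height 0, hence so does
        \<open>A2\<close>, and the \<open>E\<close> following \<open>A2\<close> would go below the
        diagonal.\<close>
      have "0 \<le> height T" using mpath_prefix_height[of 0 T T'] B 3 by simp
      moreover have "0 \<le> height T'" using mpath_prefix_height[of 0 T' "E # C"] R 3 by simp
      moreover have "height T + height T' = 0" using mpath_height[OF B] 3 by simp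
      moreover have "height A2 + height T = 0" using mpath_height[OF first_return_le_N.hyps(2)] 3 by simp
      moreover have "0 \<le> height (A2 @ [E])"
        using mpath_prefix_height[of 0 "A2 @ [E]" "B @ C"] m2 by simp
      ultimately show ?thesis by simp
    qed
  next
    case 3
    have h: "height A' - 1 + height S' = 0" using mpath_height[OF Z(2)] 3 by simp
    have h': "0 \<le> height (A' @ [E])"
      using mpath_prefix_height[of 0 "A' @ [E]" S'] 3 Z(2) by simp
    consider S2 where "S' = B @ S2" "C = S2 @ E # Z"
      | S2 where "B = S' @ E # S2"
      using 3(2) by (auto simp: append_eq_append_conv2 Cons_eq_append_conv append_eq_Cons_conv)
    then show ?thesis
    proof cases
      case (1 S2)
      have m: "mpath 0 (A' @ E # B @ S2)" using 1 3 Z(2) by simp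
      then have m': "mpath 0 (A' @ B @ E # S2)" using mpath_exchange B by blast
      have Pa: "Pa = A' @ B @ E # S2 \<and> Pb @ R = Z"
        using first_return_unique[of Pa "A' @ B @ E # S2" "Pb @ R" Z] first_return_le_N.hyps(1) m' eq 1
        by simp
      have "mpath 0 (A' @ E # B @ S2 @ Pb)"
        using m first_return_le_N.hyps(2) mpath_append[OF m, of 0 Pb] by simp
      then have "first_return_le (A' @ E # B @ S2 @ Pb) Q"
        using first_return_le_N.IH(1)[of A' B "S2 @ Pb"] Pa B by simp
      then have "first_return_le (N # (A' @ E # B @ S2) @ E # Pb @ R) (N # Q @ E # S)"
        using first_return_le.first_return_le_N[of "A' @ E # B @ S2" Pb Q R S] m first_return_le_N.hyps by simp
      then show ?thesis using A 1 Pa by simp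
    next
      case (2 S2)
      \<comment> \<open>As \<open>A'\<close> has height at least 1, \<open>S'\<close> has height at
        most 0, and the \<open>E\<close> after it would take \<open>B\<close> below its starting
        height.\<close>
      have "0 \<le> height (S' @ [E])"
        using mpath_prefix_height[of 0 "S' @ [E]" S2] B 2 by simp
      with h h' show ?thesis by simp
    qed
  qed
qed

section \<open>Exchanges generate the first-return order\<close>

lemma exchange_append: "exchange P Q \<Longrightarrow> exchange (A @ P @ C) (A @ Q @ C)"
  unfolding exchange_def by (metis append.assoc append_Cons)

lemma exchanges_append: "exchange\<^sup>*\<^sup>* P Q \<Longrightarrow> exchange\<^sup>*\<^sup>* (A @ P @ C) (A @ Q @ C)"
  by (induction rule: rtranclp_induct) (auto intro: exchange_append rtranclp.rtrancl_into_rtrancl)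

lemma exchange_mpath: "exchange P Q \<Longrightarrow> mpath 0 P \<Longrightarrow> mpath 0 Q"
  by (auto simp: exchange_def intro: mpath_exchange prime_path_mpath)

text \<open>The \<open>E\<close> passes the prime blocks of \<open>B\<close> one after another, each
  passage being one exchange.\<close>

lemma exchanges_E: "mpath 0 B \<Longrightarrow> exchange\<^sup>*\<^sup>* (E # B) (B @ [E])"
proof (induction rule: mpath_induct)
  case Nil
  then show ?case by simp
next
  case (D P)
  have "exchange (E # D # P) (D # E # P)"
    unfolding exchange_def prime_path_def
    by (rule exI[of _ "[]"], rule exI[of _ "[D]"]) auto
  then show ?case using exchanges_append[OF D.IH, of "[D]" "[]"]
    by (simp add: converse_rtranclp_into_rtranclp)
next
  case (N A B)
  have "exchange (E # N # A @ E # B) (N # A @ E # E # B)"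
    unfolding exchange_def prime_path_def
    by (rule exI[of _ "[]"], rule exI[of _ "N # A @ [E]"]) (use N in auto)
  then show ?case using exchanges_append[OF N.IH(2), of "N # A @ [E]" "[]"]
    by (simp add: converse_rtranclp_into_rtranclp)
qed

lemma first_return_le_imp_exchanges: "first_return_le P Q \<Longrightarrow> exchange\<^sup>*\<^sup>* P Q"
proof (induction rule: first_return_le.induct)
  case first_return_le_Nil
  then show ?case by simp
next
  case (first_return_le_D P Q)
  then show ?case using exchanges_append[of P Q "[D]" "[]"] by simp
next
  case (first_return_le_N A B Q R S)
  \<comment> \<open>First the closing \<open>E\<close> of the arch moves behind \<open>B\<close>;
    then the inner path is raised to \<open>Q\<close> and the tail to \<open>S\<close>.\<close>
  have "exchange\<^sup>*\<^sup>* (N # A @ E # B @ R) (N # A @ B @ E # R)"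
    using exchanges_append[OF exchanges_E[OF first_return_le_N.hyps(2)], of "N # A" R] by simp
  also have "exchange\<^sup>*\<^sup>* \<dots> (N # Q @ E # R)"
    using exchanges_append[OF first_return_le_N.IH(1), of "[N]" "E # R"] by simp
  also have "exchange\<^sup>*\<^sup>* \<dots> (N # Q @ E # S)"
    using exchanges_append[OF first_return_le_N.IH(2), of "N # Q @ [E]" "[]"] by simp
  finally show ?case .
qed

text \<open>Starting from reflexivity, descending one cover preserves \<open>first_return_le\<close>
  by \<open>first_return_le_exchange\<close>. Conversely, a chain of exchanges is a chain of covers
  because exchanges preserve being a path.\<close>

lemma motzkin_le_iff_first_return_le:
  assumes "mpath 0 Q"
  shows "motzkin_le P Q \<longleftrightarrow> first_return_le P Q"
proof
  assume "motzkin_le P Q"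
  then show "first_return_le P Q" unfolding motzkin_le_def
  proof (induction rule: converse_rtranclp_induct)
    case base
    then show ?case using assms by (rule first_return_le_refl)
  next
    case (step P P')
    then show ?case
      by (auto simp: motzkin_covers_iff exchange_def intro: first_return_le_exchange prime_path_mpath)
  qed
next
  assume le: "first_return_le P Q"
  from first_return_le_imp_exchanges[OF le]
  have "motzkin_covers\<^sup>*\<^sup>* P Q \<and> mpath 0 Q"
  proof (induction rule: rtranclp_induct)
    case base
    then show ?case using first_return_le_mpath[OF le] by simp
  next
    case (step P' Q)
    then show ?case
      by (auto simp: motzkin_covers_iff intro: exchange_mpath rtranclp.rtrancl_into_rtrancl)
  qed
  then show "motzkin_le P Q" by (simp add: motzkin_le_def)
qed

text \<open>For \<open>n = 0\<close> this contains the pair of empty paths, which is not an interval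
  of Motzkin paths; it supplies the constant term 1 of the series below.\<close>

definition le_pairs :: "nat \<Rightarrow> (step list \<times> step list) set" where
  "le_pairs n = {(P, Q). first_return_le P Q \<and> length P = n}"

lemma motzkin_intervals_subset: "motzkin_intervals n \<subseteq> le_pairs n"
  by (auto simp: motzkin_intervals_def motzkin_paths_def motzkin_path_iff le_pairs_def
      motzkin_le_iff_first_return_le)

lemma motzkin_intervals_eq:
  assumes "n \<ge> 1"
  shows "motzkin_intervals n = le_pairs n"
proof
  show "le_pairs n \<subseteq> motzkin_intervals n"
  proof clarify
    fix P Q
    assume "(P, Q) \<in> le_pairs n"
    then have "first_return_le P Q" "length P = n" by (auto simp: le_pairs_def)
    with first_return_le_mpath[of P Q] first_return_le_length[of P Q] assms show "(P, Q) \<in> motzkin_intervals n"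
      by (auto simp: motzkin_intervals_def motzkin_paths_def motzkin_path_iff motzkin_le_iff_first_return_le)
  qed
qed (rule motzkin_intervals_subset)

section \<open>Counting intervals by contacts\<close>

text \<open>
  The number of non-initial contacts with the diagonal of a path started at height \<open>h\<close>; the value for
  an \<open>E\<close> step at height 0 is irrelevant.
\<close>
fun returns :: "nat \<Rightarrow> step list \<Rightarrow> nat" where
  "returns h [] = 0"
| "returns h (N # P) = returns (Suc h) P"
| "returns h (D # P) = (if h = 0 then 1 else 0) + returns h P"
| "returns 0 (E # P) = returns 0 P"
| "returns (Suc h) (E # P) = (if h = 0 then 1 else 0) + returns h P"

lemma returns_append: "mpath h A \<Longrightarrow> returns h (A @ B) = returns h A + returns 0 B"
  by (induction h A rule: mpath.induct) auto

lemma returns_append_Suc: "mpath 0 A \<Longrightarrow> returns (Suc h) (A @ B) = returns (Suc h) B"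
proof -
  have "mpath k A \<Longrightarrow> returns (Suc (h + k)) (A @ B) = returns (Suc h) B" for k
    by (induction k A rule: mpath.induct) auto
  from this[of 0] show "mpath 0 A \<Longrightarrow> ?thesis" by simp
qed

lemma returns_N: "mpath 0 A \<Longrightarrow> returns 0 (N # A @ E # B) = Suc (returns 0 B)"
  by (simp add: returns_append_Suc)

text \<open>These are the possible choices of \<open>A\<close> and \<open>B\<close> in
  \<open>first_return_le_N\<close> once \<open>A @ B\<close> is given: one for each contact, the
  starting point included.\<close>

definition splits :: "step list \<Rightarrow> (step list \<times> step list) set" where
  "splits P = {(A, B). P = A @ B \<and> mpath 0 A \<and> mpath 0 B}"

lemma finite_splits: "finite (splits P)"
proof (rule finite_subset)
  show "splits P \<subseteq> (\<lambda>i. (take i P, drop i P)) ` {..length P}"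
  proof
    fix x assume "x \<in> splits P"
    then obtain A B where "x = (A, B)" "P = A @ B" by (auto simp: splits_def)
    then show "x \<in> (\<lambda>i. (take i P, drop i P)) ` {..length P}"
      by (intro image_eqI[of _ _ "length A"]) auto
  qed
qed simp

lemma splits_D: "mpath 0 P \<Longrightarrow>
    splits (D # P) = insert ([], D # P) ((\<lambda>(A, B). (D # A, B)) ` splits P)"
  by (auto simp: splits_def Cons_eq_append_conv image_iff)

lemma splits_N:
  assumes "mpath 0 A" "mpath 0 B"
  shows "splits (N # A @ E # B) =
    insert ([], N # A @ E # B) ((\<lambda>(A', B'). (N # A @ E # A', B')) ` splits B)"
    (is "?L = ?R")
proof
  show "?R \<subseteq> ?L" using assms by (auto simp: splits_def mpath_append)
  show "?L \<subseteq> ?R"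
  proof clarify
    fix X Y
    assume XY: "(X, Y) \<in> splits (N # A @ E # B)"
      and no: "(X, Y) \<notin> (\<lambda>(A', B'). (N # A @ E # A', B')) ` splits B"
    have "X = []"
    proof (rule ccontr)
      assume "X \<noteq> []"
      then obtain X' where X: "X = N # X'" "X' @ Y = A @ E # B" "mpath 0 Y" "mpath (Suc 0) X'"
        using XY by (cases X) (auto simp: splits_def)
      then obtain A0 A' where A0: "X' = A0 @ E # A'" "mpath 0 A0" "mpath 0 A'"
        using first_return by blast
      then have "A0 = A \<and> A' @ Y = B"
        using first_return_unique[of A0 A "A' @ Y" B] X assms by simp
      then have "(A', Y) \<in> splits B" "X = N # A @ E # A'"
        using A0 X by (auto simp: splits_def)
      with no show False by force
    qed
    with XY show "X = [] \<and> Y = N # A @ E # B" by (simp add: splits_def)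
  qed
qed

text \<open>As the cut runs through the contacts of \<open>P\<close>, the number of returns after it
  takes every value from \<open>returns 0 P\<close> down to 0 exactly once.\<close>

lemma sum_splits_returns:
  fixes f :: "nat \<Rightarrow> 'a::comm_monoid_add"
  assumes "mpath 0 P"
  shows "(\<Sum>(A, B)\<in>splits P. f (returns 0 B)) = (\<Sum>j\<le>returns 0 P. f j)"
  using assms
proof (induction rule: mpath_induct)
  case Nil
  have "splits [] = {([], [])}" by (auto simp: splits_def)
  then show ?case by simp
next
  case (D P)
  have "(\<Sum>(A, B)\<in>splits (D # P). f (returns 0 B)) =
      f (returns 0 (D # P)) + (\<Sum>(A, B)\<in>(\<lambda>(A, B). (D # A, B)) ` splits P. f (returns 0 B))"
    unfolding splits_D[OF D(1)] by (subst sum.insert) (auto simp: finite_splits)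
  also have "(\<Sum>(A, B)\<in>(\<lambda>(A, B). (D # A, B)) ` splits P. f (returns 0 B)) =
      (\<Sum>(A, B)\<in>splits P. f (returns 0 B))"
    by (subst sum.reindex) (auto simp: inj_on_def case_prod_unfold)
  finally show ?case using D.IH by (simp add: add.commute)
next
  case (N A B)
  have "(\<Sum>(A', B')\<in>splits (N # A @ E # B). f (returns 0 B')) =
      f (returns 0 (N # A @ E # B)) +
      (\<Sum>(A', B')\<in>(\<lambda>(A', B'). (N # A @ E # A', B')) ` splits B. f (returns 0 B'))"
    unfolding splits_N[OF N(1,2)] by (subst sum.insert) (auto simp: finite_splits)
  also have "(\<Sum>(A', B')\<in>(\<lambda>(A', B'). (N # A @ E # A', B')) ` splits B. f (returns 0 B')) =
      (\<Sum>(A', B')\<in>splits B. f (returns 0 B'))"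
    by (subst sum.reindex) (auto simp: inj_on_def case_prod_unfold)
  finally show ?case using N.IH(2)
    by (simp add: add.commute returns_N[OF N(1)] del: returns.simps)
qed

section \<open>Recursive decomposition of the intervals\<close>

lemma finite_le_pairs: "finite (le_pairs n)"
proof (rule finite_subset)
  have "UNIV = {N, E, D}" using step.exhaust by auto
  then have "finite (UNIV :: step set)" by (metis finite.emptyI finite.insertI)
  then have "finite {P :: step list. set P \<subseteq> UNIV \<and> length P = n}"
    by (rule finite_lists_length_eq)
  then show "finite ({P :: step list. length P = n} \<times> {P :: step list. length P = n})" by simp
  show "le_pairs n \<subseteq> {P. length P = n} \<times> {P. length P = n}"
    by (auto simp: le_pairs_def dest: first_return_le_length)
qed

lemma le_pairs_0: "le_pairs 0 = {([], [])}"
  by (auto simp: le_pairs_def first_return_le_Nil dest: first_return_le_length)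

text \<open>The components are the length of the inner interval, that interval, a cut of its lower
  path, and the interval after the first return. The arch takes two further steps, hence
  \<open>n - Suc i\<close> for total length \<open>Suc n\<close>.\<close>

definition glue_index ::
  "nat \<Rightarrow> (nat \<times> (step list \<times> step list) \<times> (step list \<times> step list) \<times> (step list \<times> step list)) set"
where
  "glue_index n =
     (SIGMA i:{..<n}. SIGMA PQ:le_pairs i. splits (fst PQ) \<times> le_pairs (n - Suc i))"

definition glue ::
  "nat \<times> (step list \<times> step list) \<times> (step list \<times> step list) \<times> (step list \<times> step list)
    \<Rightarrow> step list \<times> step list"
where
  "glue = (\<lambda>(i, (P, Q), (A, B), (R, S)). (N # A @ E # B @ R, N # Q @ E # S))"

lemma mem_glue_index:
  "(i, (P, Q), (A, B), (R, S)) \<in> glue_index n \<longleftrightarrow>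
    i < n \<and> first_return_le P Q \<and> length P = i \<and> P = A @ B \<and> mpath 0 A \<and> mpath 0 B \<and>
    first_return_le R S \<and> length R = n - Suc i"
  by (auto simp: glue_index_def le_pairs_def splits_def)

lemma le_pairs_Suc:
  "le_pairs (Suc n) = (\<lambda>(P, Q). (D # P, D # Q)) ` le_pairs n \<union> glue ` glue_index n"
    (is "?L = ?R1 \<union> ?R2")
proof
  show "?L \<subseteq> ?R1 \<union> ?R2"
  proof clarify
    fix P Q
    assume PQ: "(P, Q) \<in> le_pairs (Suc n)" and no: "(P, Q) \<notin> ?R2"
    from PQ have "first_return_le P Q" "length P = Suc n" by (auto simp: le_pairs_def)
    then show "(P, Q) \<in> ?R1"
    proof cases
      case (first_return_le_D P' Q')
      then show ?thesis using \<open>length P = Suc n\<close> by (auto simp: le_pairs_def)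
    next
      case (first_return_le_N A B Q' R S)
      then have "(length (A @ B), (A @ B, Q'), (A, B), (R, S)) \<in> glue_index n"
        using \<open>length P = Suc n\<close> by (simp add: mem_glue_index)
      then have "glue (length (A @ B), (A @ B, Q'), (A, B), (R, S)) \<in> ?R2" by (rule imageI)
      then show ?thesis using no first_return_le_N by (simp add: glue_def)
    qed simp
  qed
  have "?R1 \<subseteq> ?L" by (auto simp: le_pairs_def intro: first_return_le.intros)
  moreover have "?R2 \<subseteq> ?L"
  proof
    fix x assume "x \<in> ?R2"
    then obtain i P Q A B R S where
      "(i, (P, Q), (A, B), (R, S)) \<in> glue_index n" "x = (N # A @ E # B @ R, N # Q @ E # S)"
      by (auto simp: glue_def)
    then show "x \<in> ?L" by (auto simp: mem_glue_index le_pairs_def intro: first_return_le.intros)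
  qed
  ultimately show "?R1 \<union> ?R2 \<subseteq> ?L" by blast
qed

text \<open>The upper path determines \<open>Q\<close> and \<open>S\<close>, the lower one
  \<open>A\<close>; the end of \<open>B\<close> is then known because \<open>A @ B\<close> has the
  same length as \<open>Q\<close>.\<close>

lemma inj_on_glue: "inj_on glue (glue_index n)"
proof (rule inj_onI)
  fix x y
  assume "x \<in> glue_index n" "y \<in> glue_index n" "glue x = glue y"
  moreover obtain i P Q A B R S where x: "x = (i, (P, Q), (A, B), (R, S))" by (metis prod.exhaust)
  moreover obtain i' P' Q' A' B' R' S' where y: "y = (i', (P', Q'), (A', B'), (R', S'))"
    by (metis prod.exhaust)
  ultimately have mx: "(i, (P, Q), (A, B), (R, S)) \<in> glue_index n"
    and my: "(i', (P', Q'), (A', B'), (R', S')) \<in> glue_index n"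
    and eqs: "A @ E # B @ R = A' @ E # B' @ R'" "Q @ E # S = Q' @ E # S'"
    by (auto simp: glue_def)
  have Q: "Q = Q' \<and> S = S'"
    using mx my by (intro first_return_unique eqs(2)) (auto simp: mem_glue_index dest: first_return_le_mpath)
  have A: "A = A' \<and> B @ R = B' @ R'"
    using mx my by (intro first_return_unique eqs(1)) (auto simp: mem_glue_index)
  have "length (A @ B) = length (A' @ B')"
    using mx my Q by (auto simp: mem_glue_index dest!: first_return_le_length)
  with A have "B = B' \<and> R = R'" by simp
  with A Q mx my show "x = y" unfolding x y by (auto simp: mem_glue_index)
qed

lemma sum_glue_index:
  "sum f (glue_index n) = (\<Sum>i<n. \<Sum>PQ\<in>le_pairs i. \<Sum>AB\<in>splits (fst PQ).
     \<Sum>RS\<in>le_pairs (n - Suc i). f (i, PQ, AB, RS))"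
proof -
  have "sum f (glue_index n) =
      (\<Sum>i<n. \<Sum>y\<in>(SIGMA PQ:le_pairs i. splits (fst PQ) \<times> le_pairs (n - Suc i)). f (i, y))"
    unfolding glue_index_def
    by (subst sum.Sigma) (auto simp: finite_le_pairs finite_splits finite_SigmaI)
  also have "\<dots> = (\<Sum>i<n. \<Sum>PQ\<in>le_pairs i.
      \<Sum>z\<in>splits (fst PQ) \<times> le_pairs (n - Suc i). f (i, PQ, z))"
    by (subst sum.Sigma) (auto simp: finite_le_pairs finite_splits case_prod_unfold)
  finally show ?thesis by (simp add: sum.cartesian_product case_prod_unfold)
qed

definition path_weight :: "'a::comm_ring_1 \<Rightarrow> 'a \<Rightarrow> step list \<Rightarrow> 'a" where
  "path_weight u a P = u ^ count_list P D * a ^ returns 0 P"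

definition W :: "'a::comm_ring_1 \<Rightarrow> 'a \<Rightarrow> nat \<Rightarrow> 'a" where
  "W u a n = (\<Sum>(P, Q)\<in>le_pairs n. path_weight u a P)"

text \<open>By \<open>sum_splits_returns\<close>, this counts intervals with a marked cut of the
  lower path, \<open>a\<close> marking the returns after the cut.\<close>

definition V :: "'a::comm_ring_1 \<Rightarrow> 'a \<Rightarrow> nat \<Rightarrow> 'a" where
  "V u a n = (\<Sum>(P, Q)\<in>le_pairs n. u ^ count_list P D * (\<Sum>j\<le>returns 0 P. a ^ j))"

lemma W_0: "W u a 0 = 1"
  by (simp add: W_def le_pairs_0 path_weight_def)

text \<open>Summing the geometric progression turns the marked cut into a divided difference, kept
  multiplied by \<open>a - 1\<close>.\<close>

lemma V_W: "(a - 1) * V u a n = a * W u a n - W u 1 n"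
proof -
  have geo: "(a - 1) * (\<Sum>j\<le>k. a ^ j) = a * a ^ k - 1" for k
    by (induction k) (auto simp: algebra_simps)
  have "(a - 1) * (u ^ k * (\<Sum>j\<le>l. a ^ j)) = a * (u ^ k * a ^ l) - u ^ k * 1 ^ l" for k l
    using arg_cong[OF geo[of l], of "\<lambda>x. u ^ k * x"] by (simp add: algebra_simps)
  then show ?thesis
    unfolding V_def W_def path_weight_def
    by (simp only: sum_distrib_left sum_subtractf[symmetric] case_prod_unfold)
qed

text \<open>An interval starts with \<open>D\<close> on both paths or comes from
  \<open>glue\<close>. The factor \<open>a\<close> is the contact made by the first \<open>D\<close>
  or the first arch of the lower path; the contacts of \<open>A\<close> are lifted off the diagonal,
  so only those of \<open>B\<close> and \<open>R\<close> remain.\<close>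

lemma W_Suc: "W u a (Suc n) = a * (u * W u a n + (\<Sum>i<n. V u a i * W u a (n - Suc i)))"
proof -
  have "W u a (Suc n) =
      (\<Sum>(P, Q)\<in>(\<lambda>(P, Q). (D # P, D # Q)) ` le_pairs n. path_weight u a P) +
      (\<Sum>(P, Q)\<in>glue ` glue_index n. path_weight u a P)"
    unfolding W_def le_pairs_Suc
    by (rule sum.union_disjoint)
       (auto simp: finite_le_pairs glue_def glue_index_def finite_splits)
  also have "(\<Sum>(P, Q)\<in>(\<lambda>(P, Q). (D # P, D # Q)) ` le_pairs n. path_weight u a P) =
      (\<Sum>(P, Q)\<in>le_pairs n. a * u * path_weight u a P)"
    by (subst sum.reindex) (auto simp: inj_on_def path_weight_def case_prod_unfold algebra_simps)
  also have "\<dots> = a * u * W u a n"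
    by (simp add: W_def sum_distrib_left case_prod_unfold)
  also have "(\<Sum>(P, Q)\<in>glue ` glue_index n. path_weight u a P) =
      (\<Sum>x\<in>glue_index n. path_weight u a (fst (glue x)))"
    by (subst sum.reindex[OF inj_on_glue]) (simp add: case_prod_unfold)
  also have "\<dots> = (\<Sum>(i, (P, Q), (A, B), (R, S))\<in>glue_index n.
      a * (u ^ count_list P D * a ^ returns 0 B * path_weight u a R))"
  proof (rule sum.cong[OF refl])
    fix x assume x: "x \<in> glue_index n"
    obtain i P Q A B R S where x_eq: "x = (i, (P, Q), (A, B), (R, S))" by (metis prod.exhaust)
    have "P = A @ B" "mpath 0 A" "mpath 0 B" using x unfolding x_eq by (auto simp: mem_glue_index)
    then show "path_weight u a (fst (glue x)) = (\<lambda>(i, (P, Q), (A, B), (R, S)).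
        a * (u ^ count_list P D * a ^ returns 0 B * path_weight u a R)) x"
      by (simp add: x_eq glue_def path_weight_def returns_append_Suc returns_append power_add algebra_simps)
  qed
  also have "\<dots> = (\<Sum>i<n. \<Sum>(P, Q)\<in>le_pairs i. \<Sum>(A, B)\<in>splits P. \<Sum>(R, S)\<in>le_pairs (n - Suc i).
      a * (u ^ count_list P D * a ^ returns 0 B * path_weight u a R))"
    by (simp add: sum_glue_index case_prod_unfold)
  also have "\<dots> = (\<Sum>i<n. \<Sum>(P, Q)\<in>le_pairs i.
      a * (u ^ count_list P D * (\<Sum>(A, B)\<in>splits P. a ^ returns 0 B) * W u a (n - Suc i)))"
    by (simp add: W_def sum_distrib_left sum_distrib_right case_prod_unfold mult.assoc)
       (intro sum.cong refl sum.swap)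
  also have "\<dots> = (\<Sum>i<n. \<Sum>(P, Q)\<in>le_pairs i.
      a * (u ^ count_list P D * (\<Sum>j\<le>returns 0 P. a ^ j) * W u a (n - Suc i)))"
    by (intro sum.cong refl) (auto simp: le_pairs_def sum_splits_returns dest!: first_return_le_mpath)
  also have "\<dots> = a * (\<Sum>i<n. V u a i * W u a (n - Suc i))"
    by (simp add: V_def sum_distrib_left sum_distrib_right case_prod_unfold)
  finally show ?thesis by (simp add: algebra_simps)
qed

section \<open>The functional equation\<close>

lemma X_power_dvd_iff:
  fixes f :: "'a::comm_ring_1 fps"
  shows "fps_X ^ k dvd f \<longleftrightarrow> (\<forall>n<k. f $ n = 0)"
proof
  assume "\<forall>n<k. f $ n = 0"
  then have "f = fps_X ^ k * fps_shift k f"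
    by (intro fps_ext) (auto simp: fps_X_power_mult_nth)
  then show "fps_X ^ k dvd f" by (metis dvd_triv_left)
qed (auto simp: dvd_def fps_X_power_mult_nth)

lemma zero_if_X_powers_dvd:
  fixes f :: "'a::comm_ring_1 fps"
  assumes "\<And>k. fps_X ^ k dvd f"
  shows "f = 0"
proof (rule fps_ext)
  fix n show "f $ n = 0 $ n"
    using assms[of "Suc n"] by (simp add: X_power_dvd_iff del: power_Suc)
qed

lemma dvd_diff_mult:
  fixes a b c d m :: "'a::comm_ring_1"
  assumes "m dvd a - b" "m dvd c - d"
  shows "m dvd a * c - b * d"
proof -
  have "a * c - b * d = a * (c - d) + (a - b) * d" by (simp add: algebra_simps)
  with assms show ?thesis by simp
qed

lemma dvd_diff_power:
  fixes a b m :: "'a::comm_ring_1"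
  assumes "m dvd a - b"
  shows "m dvd a ^ n - b ^ n"
  by (induction n) (auto intro: dvd_diff_mult assms)

text \<open>Banach's argument for the \<open>fps_X\<close>-adic distance: the iterates from 0 agree
  to ever higher order.\<close>

lemma fps_contraction_fixpoint:
  fixes \<Phi> :: "'a::comm_ring_1 fps \<Rightarrow> 'a fps"
  assumes contr: "\<And>k a b. fps_X ^ k dvd a - b \<Longrightarrow> fps_X ^ Suc k dvd \<Phi> a - \<Phi> b"
  shows "\<exists>a. \<Phi> a = a"
proof -
  define w where "w n = (\<Phi> ^^ n) 0" for n
  have w_Suc: "w (Suc n) = \<Phi> (w n)" for n by (simp add: w_def)
  have w_step: "fps_X ^ n dvd w (Suc n) - w n" for n
    by (induction n) (auto simp: w_Suc intro: contr[unfolded power_Suc])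
  have w_ge: "fps_X ^ n dvd w m - w n" if "n \<le> m" for n m
    using that
  proof (induction m rule: dec_induct)
    case (step m)
    have "fps_X ^ n dvd w (Suc m) - w m"
      using dvd_trans[OF le_imp_power_dvd[OF step.hyps(1)] w_step] .
    then have "fps_X ^ n dvd (w (Suc m) - w m) + (w m - w n)" using step.IH by (rule dvd_add)
    then show ?case by simp
  qed simp
  \<comment> \<open>Coefficient \<open>n\<close> no longer changes from iterate \<open>Suc n\<close>
    on.\<close>
  define L where "L = Abs_fps (\<lambda>n. w (Suc n) $ n)"
  have L: "fps_X ^ n dvd L - w n" for n
    unfolding X_power_dvd_iff
  proof clarify
    fix k assume "k < n"
    then have "fps_X ^ Suc k dvd w n - w (Suc k)" by (intro w_ge) simp
    then show "(L - w n) $ k = 0" by (auto simp: X_power_dvd_iff L_def simp del: power_Suc)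
  qed
  have "fps_X ^ n dvd \<Phi> L - L" for n
  proof -
    have "fps_X ^ Suc n dvd (\<Phi> L - w (Suc n)) - (L - w (Suc n))"
      unfolding w_Suc using contr[OF L[of n]] L[of "Suc n"] unfolding w_Suc by (rule dvd_diff)
    then have "fps_X ^ Suc n dvd \<Phi> L - L" by simp
    then show ?thesis by (auto simp: X_power_dvd_iff simp del: power_Suc)
  qed
  then have "\<Phi> L - L = 0" by (rule zero_if_X_powers_dvd)
  then show ?thesis by auto
qed

text \<open>
  Identifies the outer variable with the inner one: \<open>diag\<close> sends \<open>\<Sum>\<^sub>n G\<^sub>n(t) s\<^sup>n\<close> to \<open>\<Sum>\<^sub>n G\<^sub>n(t) t\<^sup>n\<close>. It is used to
  substitute a series in \<open>t\<close> for the catalytic variable.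
\<close>
definition diag :: "'a::comm_ring_1 fps fps \<Rightarrow> 'a fps" where
  "diag G = Abs_fps (\<lambda>m. \<Sum>n\<le>m. G $ n $ (m - n))"

lemma diag_add: "diag (G + H) = diag G + diag H"
  by (rule fps_ext) (simp add: diag_def sum.distrib)

lemma diag_diff: "diag (G - H) = diag G - diag H"
  by (rule fps_ext) (simp add: diag_def sum_subtractf)

lemma diag_const [simp]: "diag (fps_const c) = c"
proof (rule fps_ext)
  fix m
  have "diag (fps_const c) $ m = (\<Sum>n\<le>m. if n = 0 then c $ m else 0)"
    unfolding diag_def fps_nth_Abs_fps by (rule sum.cong) auto
  then show "diag (fps_const c) $ m = c $ m" by simp
qed

lemma diag_1 [simp]: "diag 1 = 1"
  using diag_const[of 1] by simp

lemma diag_X [simp]: "diag fps_X = fps_X"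
proof (rule fps_ext)
  fix m
  have "diag fps_X $ m = (\<Sum>n\<le>m. if n = 1 then (if m = 1 then 1 else 0 :: 'a) else 0)"
    unfolding diag_def fps_nth_Abs_fps by (rule sum.cong) (auto simp: fps_X_def)
  then show "diag fps_X $ m = (fps_X :: 'a fps) $ m" by (auto simp: fps_X_def)
qed

lemma diag_mult: "diag (G * H) = diag G * diag H"
proof (rule fps_ext)
  fix m
  have "diag (G * H) $ m =
      (\<Sum>n\<le>m. \<Sum>i\<le>n. \<Sum>p\<le>m - n. G $ i $ p * H $ (n - i) $ (m - n - p))"
    by (simp add: diag_def fps_mult_nth fps_sum_nth atLeast0AtMost)
  also have "\<dots> = (\<Sum>(n, i, p)\<in>(SIGMA n:{..m}. {..n} \<times> {..m - n}).
      G $ i $ p * H $ (n - i) $ (m - n - p))"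
    by (simp add: sum.Sigma sum.cartesian_product)
  \<comment> \<open>Here \<open>n\<close> is the outer degree of the product,
    \<open>k = i + p\<close> the total degree contributed by \<open>G\<close>, and
    \<open>j = n - i\<close> the outer degree contributed by \<open>H\<close>.\<close>
  also have "\<dots> = (\<Sum>(k, i, j)\<in>(SIGMA k:{..m}. {..k} \<times> {..m - k}).
      G $ i $ (k - i) * H $ j $ (m - k - j))"
    by (rule sum.reindex_bij_witness
        [where i = "\<lambda>(k, i, j). (i + j, i, k - i)" and j = "\<lambda>(n, i, p). (i + p, i, n - i)"])
       (auto simp: diff_diff_eq add.commute intro!: arg_cong2[where f = "(*)"] arg_cong2[where f = fps_nth])
  also have "\<dots> = (\<Sum>k\<le>m. \<Sum>i\<le>k. \<Sum>j\<le>m - k. G $ i $ (k - i) * H $ j $ (m - k - j))"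
    by (simp add: sum.Sigma sum.cartesian_product)
  also have "\<dots> = (diag G * diag H) $ m"
    by (simp add: diag_def fps_mult_nth atLeast0AtMost sum_product)
  finally show "diag (G * H) $ m = (diag G * diag H) $ m" .
qed

lemma diag_power: "diag (G ^ n) = diag G ^ n"
  by (induction n) (auto simp: diag_mult)

text \<open>The outer \<open>fps_X\<close> marks the length and \<open>a\<close> lies in the
  coefficient ring, so \<open>a\<close> may itself be a series. Eliminating the series of marked
  cuts by \<open>V_W\<close> leaves an equation quadratic in \<open>Wa\<close>.\<close>

lemma W_functional_equation:
  fixes u a :: "'a::comm_ring_1"
  defines "Wa \<equiv> Abs_fps (W u a)" and "W1 \<equiv> Abs_fps (W u 1)"
  shows "(fps_const a - 1) * (Wa - 1) = fps_const a * Wa *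
    (fps_X ^ 2 * (fps_const a * Wa - W1) + fps_const u * fps_X * (fps_const a - 1))"
proof -
  define Va where "Va = Abs_fps (V u a)"
  have eq: "Wa = 1 + fps_X * (fps_const a * (fps_const u * Wa + fps_X * (Va * Wa)))"
  proof (rule fps_ext)
    fix n
    show "Wa $ n =
        (1 + fps_X * (fps_const a * (fps_const u * Wa + fps_X * (Va * Wa)))) $ n"
    proof (cases n)
      case 0
      then show ?thesis by (simp add: Wa_def W_0)
    next
      case (Suc k)
      have "(\<Sum>i<k. V u a i * W u a (k - Suc i)) = (fps_X * (Va * Wa)) $ k"
      proof (cases k)
        case (Suc l)
        have "(Va * Wa) $ l = (\<Sum>i\<le>l. V u a i * W u a (l - i))"
          by (simp add: fps_mult_nth Va_def Wa_def atLeast0AtMost)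
        with Suc show ?thesis by (simp add: lessThan_Suc_atMost)
      qed simp
      then show ?thesis using Suc by (simp add: Wa_def W_Suc)
    qed
  qed
  have V: "(fps_const a - 1) * Va = fps_const a * Wa - W1"
  proof (rule fps_ext)
    fix n
    have "((fps_const a - 1) * Va) $ n = (a - 1) * V u a n"
      by (simp add: left_diff_distrib Va_def)
    then show "((fps_const a - 1) * Va) $ n = (fps_const a * Wa - W1) $ n"
      by (simp add: V_W Wa_def W1_def)
  qed
  have combine: "(A - 1) * (Y - 1) = A * Y * (t ^ 2 * (A * Y - Y1) + U * t * (A - 1))"
    if "Y - 1 = t * (A * (U * Y + t * (Z * Y)))" "(A - 1) * Z = A * Y - Y1"
    for A U Y Z Y1 t :: "'a fps"
  proof -
    have "(A - 1) * (Y - 1) = t * A * ((A - 1) * U * Y + t * (((A - 1) * Z) * Y))"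
      unfolding that(1) by (simp add: algebra_simps)
    then show ?thesis unfolding that(2) by (simp add: algebra_simps power2_eq_square)
  qed
  show ?thesis
    by (rule combine[OF _ V]) (metis eq add_diff_cancel_left')
qed

text \<open>
  The generating function of the intervals (including the empty one) in which every contact of the
  lower path is counted by the catalytic series \<open>a\<close>.
\<close>
definition F :: "series \<Rightarrow> series" where
  "F a = diag (Abs_fps (W u_var a))"

lemma F_functional_equation:
  "(a - 1) * (F a - 1) =
    a * F a * (t_var ^ 2 * (a * F a - F 1) + u_var * t_var * (a - 1))"
  using arg_cong[OF W_functional_equation[of a u_var], of diag]
  by (simp add: diag_mult diag_diff diag_add diag_power F_def t_var_def)

text \<open>Each \<open>W u_var a n\<close> is a polynomial in \<open>a\<close>, so congruences pass
  to \<open>F\<close>. This stands in for continuity of \<open>F\<close>, both in the fixed-point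
  argument and when the catalytic series is perturbed.\<close>

lemma F_cong:
  assumes "fps_X ^ k dvd a - b"
  shows "fps_X ^ k dvd F a - F b"
proof -
  have W: "fps_X ^ k dvd W u_var a n - W u_var b n" for n
    unfolding W_def path_weight_def sum_subtractf[symmetric]
    by (auto intro!: dvd_sum dvd_diff_mult dvd_diff_power assms)
  have "F a - F b = diag (Abs_fps (\<lambda>n. W u_var a n - W u_var b n))"
    unfolding F_def diag_diff[symmetric] by (rule arg_cong[of _ _ diag], rule fps_ext) simp
  then show ?thesis
    using W unfolding X_power_dvd_iff by (auto simp: diag_def intro!: sum.neutral)
qed

lemma F_nth_0: "F a $ 0 = 1"
  by (simp add: F_def diag_def W_0)

lemma fps_const_sum: "fps_const (sum f A) = (\<Sum>x\<in>A. fps_const (f x))"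
  by (induction A rule: infinite_finite_induct) (auto simp flip: fps_const_add)

lemma F_1: "F 1 = 1 + F1"
proof (rule fps_ext)
  fix m
  have W1: "W u_var 1 n = fps_const (\<Sum>(P, Q)\<in>le_pairs n. [:0, 1:] ^ count_list P D)" for n
    by (simp add: W_def path_weight_def u_var_def case_prod_unfold fps_const_sum)
  \<comment> \<open>With \<open>a = 1\<close> the weights do not involve \<open>t\<close>, so the
    diagonal keeps only the term \<open>n = m\<close>.\<close>
  have "F 1 $ m = (\<Sum>n\<le>m. if n = m then (\<Sum>(P, Q)\<in>le_pairs m. [:0, 1:] ^ count_list P D) else 0)"
    unfolding F_def diag_def by (auto simp: W1 intro!: sum.cong)
  also have "\<dots> = (\<Sum>(P, Q)\<in>le_pairs m. [:0, 1:] ^ count_list P D)" by simp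
  also have "\<dots> = (1 + F1) $ m"
  proof (cases m)
    case 0
    then show ?thesis by (simp add: le_pairs_0 F1_def)
  next
    case (Suc k)
    then show ?thesis by (simp add: F1_def motzkin_intervals_eq diag_steps_def)
  qed
  finally show "F 1 $ m = (1 + F1) $ m" .
qed

section \<open>Elements of a finite extension are algebraic\<close>

definition ring_embedding :: "('a::comm_ring_1 \<Rightarrow> 'b::comm_ring_1) \<Rightarrow> bool" where
  "ring_embedding f \<longleftrightarrow> f 1 = 1 \<and> (\<forall>x y. f (x + y) = f x + f y) \<and>
     (\<forall>x y. f (x * y) = f x * f y) \<and> inj f"

lemma ring_embedding_simps:
  assumes "ring_embedding f"
  shows "f 1 = 1" "f (x + y) = f x + f y" "f (x * y) = f x * f y" "f 0 = 0" "f (- x) = - f x"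
    "f (x - y) = f x - f y" "f (x ^ n) = f x ^ n" "f x = 0 \<longleftrightarrow> x = 0" "f (numeral k) = numeral k"
proof -
  have add: "f (x + y) = f x + f y" for x y using assms by (simp add: ring_embedding_def)
  have mult: "f (x * y) = f x * f y" for x y using assms by (simp add: ring_embedding_def)
  show one: "f 1 = 1" using assms by (simp add: ring_embedding_def)
  show "f (x + y) = f x + f y" "f (x * y) = f x * f y" by (rule add mult)+
  show zero: "f 0 = 0" using add[of 0 0] by simp
  show minus: "f (- x) = - f x" for x using add[of x "- x"] zero by (simp add: eq_neg_iff_add_eq_0 add.commute)
  show "f (x - y) = f x - f y" using add[of x "- y"] minus[of y] by simp
  show "f (x ^ n) = f x ^ n" by (induction n) (simp_all add: one mult)
  show "f x = 0 \<longleftrightarrow> x = 0" using assms zero by (metis injD ring_embedding_def)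
  show "f (numeral k) = numeral k"
    by (induction k) (simp_all only: numeral.simps one add)
qed

text \<open>The extension of an embedding to the fraction field; by \<open>fract_lift_Fract\<close>
  the chosen representation does not matter.\<close>

definition fract_lift :: "('a::idom \<Rightarrow> 'b::field) \<Rightarrow> 'a fract \<Rightarrow> 'b" where
  "fract_lift f x = (SOME y. \<exists>a b. b \<noteq> 0 \<and> x = Fract a b \<and> y = f a / f b)"

lemma fract_lift_Fract:
  assumes f: "ring_embedding f" and b: "b \<noteq> 0"
  shows "fract_lift f (Fract a b) = f a / f b"
proof -
  note f_simps = ring_embedding_simps[OF f]
  have "\<exists>a' b'. b' \<noteq> 0 \<and> Fract a b = Fract a' b' \<and> fract_lift f (Fract a b) = f a' / f b'"
    unfolding fract_lift_def by (rule someI) (use b in blast)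
  then obtain a' b' where ab: "b' \<noteq> 0" "Fract a b = Fract a' b'"
    "fract_lift f (Fract a b) = f a' / f b'" by blast
  then have "a * b' = a' * b" using b by (simp add: eq_fract)
  then have "f a * f b' = f a' * f b" by (metis f_simps(3))
  then show ?thesis using ab b by (simp add: frac_eq_eq f_simps)
qed

lemma ring_embedding_fract_lift:
  assumes f: "ring_embedding f"
  shows "ring_embedding (fract_lift f)"
proof -
  note f_simps = ring_embedding_simps[OF f]
  have one: "fract_lift f 1 = 1"
    using fract_lift_Fract[OF f, of 1 1] by (simp add: One_fract_def[symmetric] f_simps)
  have add: "fract_lift f (x + y) = fract_lift f x + fract_lift f y" for x y
    by (cases x; cases y) (simp add: fract_lift_Fract[OF f] f_simps add_frac_eq)
  have mult: "fract_lift f (x * y) = fract_lift f x * fract_lift f y" for x y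
    by (cases x; cases y) (simp add: fract_lift_Fract[OF f] f_simps)
  have "x = 0" if "fract_lift f x = 0" for x
    using that by (cases x) (auto simp: fract_lift_Fract[OF f] f_simps eq_fract Zero_fract_def)
  moreover have "fract_lift f (x - y) = fract_lift f x - fract_lift f y" for x y
    using add[of "x - y" y] by simp
  ultimately have "inj (fract_lift f)" by (metis eq_iff_diff_eq_0 injI)
  with one add mult show ?thesis by (simp add: ring_embedding_def)
qed

text \<open>All powers of \<open>y\<close> lie in the span of the \<open>d\<close> powers of
  \<open>x\<close> below the degree \<open>d\<close> of \<open>p\<close>. Hence \<open>d + 1\<close>
  powers of \<open>y\<close> are linearly dependent, and the dependence is the polynomial
  \<open>r\<close>.\<close>

lemma algebraic_polynomial_value:
  fixes j :: "'k::field \<Rightarrow> 'a::field"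
  assumes j: "ring_embedding j"
    and p: "p \<noteq> 0" "poly (map_poly j p) x = 0"
    and y: "y = poly (map_poly j q) x"
  shows "\<exists>r. r \<noteq> 0 \<and> poly (map_poly j r) y = 0"
proof -
  note j_simps = ring_embedding_simps[OF j]
  interpret vs: vector_space "\<lambda>c v. j c * v"
    by unfold_locales (simp_all add: j_simps algebra_simps)
  define d where "d = degree p"
  define T where "T = (\<lambda>i. x ^ i) ` {..<d}"
  have poly_j: "poly (map_poly j s) z = (\<Sum>i\<le>degree s. j (coeff s i) * z ^ i)"
    for s :: "'k poly" and z
    using degree_map_poly[of j s]
    by (simp add: poly_altdef coeff_map_poly j_simps)
  have powers: "x ^ n \<in> vs.span T" for n
  proof (induction n rule: less_induct)
    case (less n)
    show ?case
    proof (cases "n < d")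
      case True
      then show ?thesis unfolding T_def by (intro vs.span_base) auto
    next
      case False
      then obtain m where n: "n = d + m" using le_Suc_ex not_le by blast
      define c where "c = coeff p d"
      have c: "c \<noteq> 0" using p(1) by (simp add: d_def c_def)
      have "(\<Sum>i<d. j (coeff p i) * x ^ i) + j c * x ^ d = 0"
        using p(2) unfolding poly_j d_def[symmetric] c_def
        by (simp add: lessThan_Suc_atMost[symmetric])
      then have "j (inverse c) * x ^ m * ((\<Sum>i<d. j (coeff p i) * x ^ i) + j c * x ^ d) = 0"
        by simp
      moreover have "j (inverse c) * j c = 1"
        using c by (metis j_simps(1,3) left_inverse)
      then have "j (inverse c) * x ^ m * (j c * x ^ d) = x ^ n"
        by (simp add: n power_add algebra_simps)
      ultimately have "j (inverse c) * x ^ m * (\<Sum>i<d. j (coeff p i) * x ^ i) + x ^ n = 0"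
        by (simp only: distrib_left)
      then have "x ^ n = - (j (inverse c) * (\<Sum>i<d. j (coeff p i) * x ^ (i + m)))"
        by (simp add: eq_neg_iff_add_eq_0 power_add sum_distrib_left algebra_simps)
      also have "\<dots> \<in> vs.span T"
        by (intro vs.span_neg vs.span_scale vs.span_sum less.IH) (simp add: n)
      finally show ?thesis .
    qed
  qed
  have mult_power: "a * x ^ m \<in> vs.span T" if "a \<in> vs.span T" for a m
    using that
  proof (induction rule: vs.span_induct_alt)
    case base
    then show ?case by (simp add: vs.span_zero)
  next
    case (step c b a)
    then obtain i where "b = x ^ i" by (auto simp: T_def)
    then have "(j c * b + a) * x ^ m = j c * x ^ (i + m) + a * x ^ m"
      by (simp add: algebra_simps power_add)
    then show ?case using powers step.IH by (simp only: vs.span_add vs.span_scale)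
  qed
  have y_powers: "y ^ n \<in> vs.span T" for n
  proof (induction n)
    case 0
    then show ?case using powers[of 0] by simp
  next
    case (Suc n)
    have "y ^ Suc n = (\<Sum>i\<le>degree q. j (coeff q i) * (y ^ n * x ^ i))"
      by (simp add: y poly_j sum_distrib_left sum_distrib_right algebra_simps)
    also have "\<dots> \<in> vs.span T"
      by (intro vs.span_sum vs.span_scale mult_power Suc.IH)
    finally show ?case .
  qed
  show ?thesis
  \<comment> \<open>Dependence is a property of sets, so coinciding powers are treated apart: they
    yield a difference of two monomials.\<close>
  proof (cases "inj_on (\<lambda>i. y ^ i) {..d}")
    case False
    then obtain a b where ab: "a \<noteq> b" "y ^ a = y ^ b" by (auto simp: inj_on_def)
    define r :: "'k poly" where "r = monom 1 a - monom 1 b"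
    have "coeff r a = 1" using ab by (simp add: r_def)
    then have "r \<noteq> 0" by auto
    moreover have "map_poly j r = monom 1 a - monom 1 b"
      by (rule poly_eqI) (simp add: r_def coeff_map_poly j_simps)
    ultimately show ?thesis using ab by (intro exI[of _ r]) (simp add: poly_monom)
  next
    case True
    define Y where "Y = (\<lambda>i. y ^ i) ` {..d}"
    have "card T \<le> d" unfolding T_def using card_image_le[of "{..<d}" "\<lambda>i. x ^ i"] by simp
    moreover have "card Y = Suc d" unfolding Y_def using True by (simp add: card_image)
    ultimately have "vs.dependent Y"
      using vs.independent_span_bound[of T Y] y_powers by (auto simp: T_def Y_def)
    then obtain f v where f: "v \<in> Y" "f v \<noteq> 0" "(\<Sum>v\<in>Y. j (f v) * v) = 0"
      using vs.dependent_finite[of Y] by (auto simp: Y_def)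
    define r where "r = (\<Sum>i\<le>d. monom (f (y ^ i)) i)"
    obtain i where i: "i \<le> d" "v = y ^ i" using f(1) by (auto simp: Y_def)
    have coeff_r: "coeff r k = (if k \<le> d then f (y ^ k) else 0)" for k
      by (simp add: r_def coeff_sum)
    have "r \<noteq> 0" using coeff_r[of i] i f(2) by auto
    moreover have "map_poly j r = (\<Sum>i\<le>d. monom (j (f (y ^ i))) i)"
      by (rule poly_eqI) (simp add: coeff_map_poly j_simps coeff_r coeff_sum)
    then have "poly (map_poly j r) y = (\<Sum>i\<le>d. j (f (y ^ i)) * y ^ i)"
      by (simp add: poly_sum poly_monom)
    then have "poly (map_poly j r) y = 0"
      using f(3) unfolding Y_def by (simp add: sum.reindex[OF True])
    ultimately show ?thesis by blast
  qed
qed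

section \<open>The double root of the discriminant\<close>

text \<open>
  The functional equation is quadratic in \<open>y = F a\<close>; the left-hand side is the square of its
  derivative in \<open>y\<close>, and the right-hand side its discriminant.
\<close>
lemma discriminant_identity:
  fixes t u a y g :: "'a::comm_ring_1"
  assumes "(a - 1) * (y - 1) = a * y * (t ^ 2 * (a * y - g) + u * t * (a - 1))"
  shows "(2 * t ^ 2 * a ^ 2 * y + ((a - 1) * (u * t * a - 1) - a * t ^ 2 * g)) ^ 2
    = ((a - 1) * (u * t * a - 1) - a * t ^ 2 * g) ^ 2 - 4 * t ^ 2 * (a ^ 3 - a ^ 2)"
proof -
  have "(2 * t ^ 2 * a ^ 2 * y + ((a - 1) * (u * t * a - 1) - a * t ^ 2 * g)) ^ 2 =
    ((a - 1) * (u * t * a - 1) - a * t ^ 2 * g) ^ 2 - 4 * t ^ 2 * (a ^ 3 - a ^ 2)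
    + 4 * t ^ 2 * a ^ 2 * (a * y * (t ^ 2 * (a * y - g) + u * t * (a - 1)) - (a - 1) * (y - 1))"
    by (simp add: algebra_simps power2_eq_square power3_eq_cube)
  then show ?thesis unfolding assms by simp
qed

text \<open>A Taylor expansion at \<open>x\<close>, where \<open>b + h * b' + h ^ 2 * v\<close> is
  the linear coefficient of the quadratic at \<open>x + h\<close>. The factor of \<open>h\<close> is
  the derivative of the discriminant.\<close>

lemma discriminant_expansion:
  fixes b b' x t h v :: "'a::comm_ring_1"
  shows "(b + h * b' + h ^ 2 * v) ^ 2 - 4 * t ^ 2 * ((x + h) ^ 3 - (x + h) ^ 2) =
    b ^ 2 - 4 * t ^ 2 * (x ^ 3 - x ^ 2) + h * (2 * b * b' - 4 * t ^ 2 * (3 * x ^ 2 - 2 * x))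
    + h ^ 2 * (b' ^ 2 + 2 * b * v + 2 * h * v * b' + h ^ 2 * v ^ 2 - 4 * t ^ 2 * (3 * x + h - 1))"
  by (simp add: algebra_simps power2_eq_square power3_eq_cube)

text \<open>Multiply the functional equation by \<open>t * x\<close>, substitute \<open>w\<close>
  for \<open>t * x * y\<close> and \<open>w ^ 2\<close> for \<open>x - 1\<close>, and cancel one
  factor \<open>w\<close>.\<close>

lemma value_equation:
  fixes t u w x y g :: "'a::idom"
  assumes eq: "(x - 1) * (y - 1) = x * y * (t ^ 2 * (x * y - g) + u * t * (x - 1))"
    and x: "x - 1 = w ^ 2" and w: "t * x * y = w" "w \<noteq> 0"
  shows "x * t ^ 2 * g = 2 * t * x * w + w ^ 2 * (u * t * x - 1)"
proof -
  have "(x - 1) * (t * x * y - t * x) = t * x * ((x - 1) * (y - 1))"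
    by (simp add: algebra_simps)
  also have "\<dots> = (t * x * y) * (t * x * (t * x * y) - x * t ^ 2 * g + u * t * x * (x - 1))"
    unfolding eq by (simp add: algebra_simps power2_eq_square)
  finally have "w ^ 2 * (w - t * x) = w * (t * x * w - x * t ^ 2 * g + u * t * x * w ^ 2)"
    by (simp only: x w)
  then have "w * (w * (w - t * x)) = w * (t * x * w - x * t ^ 2 * g + u * t * x * w ^ 2)"
    by (simp only: power2_eq_square mult.assoc)
  then have "w * (w - t * x) = t * x * w - x * t ^ 2 * g + u * t * x * w ^ 2"
    using w(2) by simp
  then show ?thesis by (simp add: algebra_simps power2_eq_square)
qed

text \<open>\<open>root\<close> is the vanishing derivative of the discriminant, freed of the factor
  \<open>- 4 * t * x\<close>. The first conclusion eliminates \<open>g\<close> between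
  \<open>root\<close> and \<open>e1\<close>; the second simplifies \<open>e1\<close> by means of the
  first.\<close>

lemma double_root_equations:
  fixes t u w x g :: "'a::idom"
  assumes nz: "t \<noteq> 0" "x \<noteq> 0"
    and x: "x - 1 = w ^ 2"
    and e1: "x * t ^ 2 * g = 2 * t * x * w + w ^ 2 * (u * t * x - 1)"
    and b': "b' = (u * t * x - 1) + u * t * (x - 1) - t ^ 2 * g"
    and root: "w * b' + t * (3 * x - 2) = 0"
  shows "w = t * x ^ 2 * (1 + u * w)" and "t * g = w - w ^ 3 - u * w ^ 4"
proof -
  have "w * (u * t * x ^ 2 - 1) + t * x ^ 2 = x * (w * b' + t * (3 * x - 2))
      + w * (x * t ^ 2 * g - (2 * t * x * w + w ^ 2 * (u * t * x - 1)))
      + (w ^ 2 - (x - 1)) * (2 * t * x + w * (u * t * x - 1))"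
    unfolding b' by (simp add: algebra_simps power2_eq_square)
  then have "w * (u * t * x ^ 2 - 1) + t * x ^ 2 = 0" unfolding e1 x root by simp
  then show e2: "w = t * x ^ 2 * (1 + u * w)" by (simp add: algebra_simps)
  have "x * (t * (t * g - (w - w ^ 3 - u * w ^ 4))) =
      (x * t ^ 2 * g - (2 * t * x * w + w ^ 2 * (u * t * x - 1)))
      + w * (t * x ^ 2 * (1 + u * w) - w) + t * x * w * (1 + u * w) * (w ^ 2 - (x - 1))"
    by (simp add: algebra_simps eval_nat_numeral)
  then have "x * (t * (t * g - (w - w ^ 3 - u * w ^ 4))) = 0"
    unfolding e1 x e2[symmetric] by simp
  then show "t * g = w - w ^ 3 - u * w ^ 4" using nz by simp
qed

text \<open>
  Applied with \<open>h = t\<^sup>k\<close> for all \<open>k\<close>, this shows that the derivative of the discriminant vanishes at \<open>x\<close>,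
  without differentiating \<open>F\<close>.
\<close>
lemma square_dvd:
  fixes h s c d :: "'a::idom"
  assumes "h \<noteq> 0" "h dvd s" "s ^ 2 = h * c + h ^ 2 * d"
  shows "h dvd c"
proof -
  obtain k where "s = h * k" using assms(2) by blast
  then have "h * (h * k ^ 2) = h * (c + h * d)"
    using assms(3) by (simp add: power2_eq_square algebra_simps)
  then have "h * k ^ 2 = c + h * d" using assms(1) by simp
  then have "c = h * (k ^ 2 - d)" by (simp add: algebra_simps)
  then show ?thesis by simp
qed

text \<open>With \<open>x = 1 + w ^ 2\<close>, the term \<open>4 * t ^ 2 * (x ^ 3 - x ^ 2)\<close>
  of the discriminant is the square of \<open>2 * t * x * w\<close>. The factor \<open>t_var\<close>
  makes the right-hand side a contraction, and the constant term 1 of \<open>F\<close> makes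
  \<open>w\<close> nonzero.\<close>

lemma ex_parametrization:
  "\<exists>w. w = t_var * ((1 + w ^ 2) * F (1 + w ^ 2)) \<and> w \<noteq> 0 \<and> w $ 0 = 0"
proof -
  define \<Phi> where "\<Phi> w = t_var * ((1 + w ^ 2) * F (1 + w ^ 2))" for w
  have "fps_X ^ Suc k dvd \<Phi> a - \<Phi> b" if "fps_X ^ k dvd a - b" for k a b
  proof -
    have "fps_X ^ k dvd (1 + a ^ 2) - (1 + b ^ 2)" using dvd_diff_power[OF that, of 2] by simp
    then have "fps_X ^ k dvd (1 + a ^ 2) * F (1 + a ^ 2) - (1 + b ^ 2) * F (1 + b ^ 2)"
      by (intro dvd_diff_mult F_cong)
    then show ?thesis
      by (simp add: \<Phi>_def t_var_def right_diff_distrib[symmetric] mult_dvd_mono)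
  qed
  then obtain w where w: "\<Phi> w = w" using fps_contraction_fixpoint by blast
  have w0: "w $ 0 = 0" by (subst w[symmetric]) (simp add: \<Phi>_def t_var_def)
  have "w $ 1 = ((1 + w ^ 2) * F (1 + w ^ 2)) $ 0"
    by (subst w[symmetric]) (simp add: \<Phi>_def t_var_def)
  also have "\<dots> = 1" using w0 by (simp add: F_nth_0)
  finally have "w \<noteq> 0" by auto
  with w w0 show ?thesis unfolding \<Phi>_def by metis
qed

lemma parametrization:
  obtains w x where "x - 1 = w ^ 2"
    and "x * t_var ^ 2 * (1 + F1) = 2 * t_var * x * w + w ^ 2 * (u_var * t_var * x - 1)"
    and "w = t_var * x ^ 2 * (1 + u_var * w)"
    and "t_var * (1 + F1) = w - w ^ 3 - u_var * w ^ 4"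
proof -
  obtain w where w: "w = t_var * ((1 + w ^ 2) * F (1 + w ^ 2))" "w \<noteq> 0" "w $ 0 = 0"
    using ex_parametrization by blast
  define x where "x = 1 + w ^ 2"
  define y where "y = F x"
  define g where "g = F 1"
  define t u where "t = t_var" and "u = u_var"
  \<comment> \<open>\<open>B a\<close> is the linear coefficient of the quadratic satisfied by
    \<open>F a\<close>, \<open>B'\<close> the derivative of \<open>B\<close> at \<open>x\<close>,
    \<open>S a\<close> the derivative of the quadratic at its root \<open>F a\<close>, and
    \<open>c\<close> the derivative of the discriminant at \<open>x\<close>.\<close>
  define B where "B a = (a - 1) * (u * t * a - 1) - a * t ^ 2 * g" for a
  define B' where "B' = (u * t * x - 1) + u * t * (x - 1) - t ^ 2 * g"
  define S where "S a = 2 * t ^ 2 * a ^ 2 * F a + B a" for a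
  define c where "c = 2 * B x * B' - 4 * t ^ 2 * (3 * x ^ 2 - 2 * x)"
  have t: "t \<noteq> 0" by (simp add: t_def t_var_def)
  have x0: "x \<noteq> 0"
  proof
    assume "x = 0"
    then have "(1 + w ^ 2) $ 0 = 0" by (simp add: x_def)
    then show False using w(3) by (simp add: power2_eq_square)
  qed
  have x1: "x - 1 = w ^ 2" by (simp add: x_def)
  have wxy: "t * x * y = w" using w(1) by (simp add: x_def y_def t_def mult.assoc)
  have eq: "(a - 1) * (F a - 1) = a * F a * (t ^ 2 * (a * F a - g) + u * t * (a - 1))" for a
    using F_functional_equation[of a] by (simp only: g_def t_def u_def)
  have e1: "x * t ^ 2 * g = 2 * t * x * w + w ^ 2 * (u * t * x - 1)"
    using value_equation[OF eq x1 wxy[unfolded y_def] w(2)] .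
  have Bx: "B x = - 2 * t * x * w"
    unfolding B_def x1 e1 by simp
  have "2 * t ^ 2 * x ^ 2 * y = 2 * t * x * (t * x * y)" by (simp add: power2_eq_square)
  then have Sx: "S x = 0" unfolding S_def y_def[symmetric] Bx wxy by simp
  \<comment> \<open>\<open>S x = 0\<close> makes \<open>S (x + h)\<close> a multiple of
    \<open>h\<close>; its square is the discriminant at \<open>x + h\<close>, whose first-order term
    is \<open>h * c\<close>.\<close>
  have "fps_X ^ k dvd c" for k
  proof -
    define h :: series where "h = fps_X ^ k"
    define r where "r = B' ^ 2 + 2 * B x * (u * t) + 2 * h * (u * t) * B'
      + h ^ 2 * (u * t) ^ 2 - 4 * t ^ 2 * (3 * x + h - 1)"
    have disc: "S a ^ 2 = B a ^ 2 - 4 * t ^ 2 * (a ^ 3 - a ^ 2)" for a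
      unfolding S_def B_def by (rule discriminant_identity[OF eq])
    have Bh: "B (x + h) = B x + h * B' + h ^ 2 * (u * t)"
      unfolding B_def B'_def by (simp add: algebra_simps power2_eq_square)
    have "S (x + h) ^ 2 = S x ^ 2 + h * c + h ^ 2 * r"
      unfolding disc Bh discriminant_expansion c_def r_def by simp
    then have sq: "S (x + h) ^ 2 = h * c + h ^ 2 * r" using Sx by simp
    have "h dvd S (x + h) - S x"
    proof -
      have hx: "h dvd (x + h) - x" by simp
      have hF: "h dvd F (x + h) - F x" unfolding h_def by (rule F_cong) simp
      have "h dvd 2 * t ^ 2 * ((x + h) ^ 2 * F (x + h) - x ^ 2 * F x)"
        by (intro dvd_mult dvd_diff_mult dvd_diff_power hx hF)
      moreover have "h dvd B (x + h) - B x" unfolding Bh by (simp add: power2_eq_square)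
      ultimately have "h dvd 2 * t ^ 2 * ((x + h) ^ 2 * F (x + h) - x ^ 2 * F x) + (B (x + h) - B x)"
        by (rule dvd_add)
      then show ?thesis by (simp add: S_def right_diff_distrib mult.assoc add_diff_add)
    qed
    then have "h dvd S (x + h)" using Sx by simp
    moreover have "h \<noteq> 0" by (simp add: h_def)
    ultimately show ?thesis using square_dvd sq unfolding h_def by blast
  qed
  then have "c = 0" by (rule zero_if_X_powers_dvd)
  moreover have "c = - (4 * (t * (x * (w * B' + t * (3 * x - 2)))))"
    unfolding c_def Bx by (simp add: algebra_simps power2_eq_square)
  ultimately have root: "w * B' + t * (3 * x - 2) = 0" using t x0 by simp
  note result = double_root_equations[OF t x0 x1 e1 B'_def root]
  show thesis
    using that[OF x1] e1 result unfolding t_def u_def g_def F_1 by blast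
qed

section \<open>The closed form\<close>

lemma ring_embedding_inverse:
  fixes f :: "'a::field \<Rightarrow> 'b::field"
  assumes "ring_embedding f"
  shows "f (inverse x) = inverse (f x)"
proof (cases "x = 0")
  case True
  then show ?thesis by (simp add: ring_embedding_simps[OF assms])
next
  case False
  then have "f (inverse x) * f x = 1"
    by (simp flip: ring_embedding_simps(3)[OF assms]) (simp add: ring_embedding_simps[OF assms])
  then show ?thesis by (metis inverse_unique mult.commute)
qed

section \<open>Algebraicity over the rational functions in \<open>t\<close> and
  \<open>u\<close>\<close>

lemma ring_embedding_to_laurent: "ring_embedding to_laurent"
  unfolding ring_embedding_def
proof (intro conjI allI injI)
  have "Abs_fps (\<lambda>n. to_fract ((1 :: series) $ n)) = 1"
    by (rule fps_ext) simp
  then show "to_laurent 1 = 1" by (simp add: to_laurent_def)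
next
  fix f g :: series
  have "Abs_fps (\<lambda>n. to_fract ((f + g) $ n)) =
      Abs_fps (\<lambda>n. to_fract (f $ n)) + Abs_fps (\<lambda>n. to_fract (g $ n))"
    by (rule fps_ext) simp
  then show "to_laurent (f + g) = to_laurent f + to_laurent g" by (simp add: to_laurent_def)
  have "Abs_fps (\<lambda>n. to_fract ((f * g) $ n)) =
      Abs_fps (\<lambda>n. to_fract (f $ n)) * Abs_fps (\<lambda>n. to_fract (g $ n))"
    by (rule fps_ext) (simp add: fps_mult_nth)
  then show "to_laurent (f * g) = to_laurent f * to_laurent g"
    by (simp add: to_laurent_def fls_times_fps_to_fls)
  assume "to_laurent f = to_laurent g"
  then show "f = g" by (auto simp: to_laurent_def fps_eq_iff)
qed

lemma ring_embedding_polynomials: "ring_embedding (\<lambda>a. to_laurent (fps_of_poly a))"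
  using ring_embedding_to_laurent
  by (auto simp: ring_embedding_def fps_of_poly_add fps_of_poly_mult inj_def)
     (metis fps_of_poly_eq_iff)

lemma algebraic_over_Q_t_u:
  assumes w: "w = t_var * (1 + w ^ 2) ^ 2 * (1 + u_var * w)"
    and f: "t_var * (1 + f) = w - w ^ 3 - u_var * w ^ 4"
  shows "algebraic_over Q_t_u (to_laurent f)"
proof -
  define j where "j = fract_lift (\<lambda>a. to_laurent (fps_of_poly a))"
  note j_Fract = fract_lift_Fract[OF ring_embedding_polynomials, folded j_def]
  have j: "ring_embedding j"
    unfolding j_def by (rule ring_embedding_fract_lift[OF ring_embedding_polynomials])
  note j_simps = ring_embedding_simps[OF j] ring_embedding_inverse[OF j]
  note l_simps = ring_embedding_simps[OF ring_embedding_to_laurent]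
  have j_range: "j c \<in> Q_t_u" for c
    by (cases c) (auto simp: j_Fract Q_t_u_def)
  define t u :: "rat poly poly fract" where "t = to_fract [:0, 1:]" and "u = to_fract [:[:0, 1:]:]"
  have j_t: "j t = to_laurent t_var"
    using j_Fract[of 1 "[:0, 1:]"] by (simp add: t_def to_fract_def t_var_def l_simps)
  have j_u: "j u = to_laurent u_var"
    using j_Fract[of 1 "[:[:0, 1:]:]"] by (simp add: u_def to_fract_def u_var_def fps_of_poly_const l_simps)
  have t: "t \<noteq> 0" by (simp add: t_def)
  define x where "x = to_laurent w"
  \<comment> \<open>\<open>p\<close> is the expanded equation of \<open>w\<close> with all terms on
    one side; \<open>q\<close> expresses \<open>f\<close> through \<open>w\<close> after division by
    \<open>t\<close>.\<close>
  define p where "p = [:t, t * u - 1, 2 * t, 2 * t * u, t, t * u:]"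
  define q where "q = [:- 1, inverse t, 0, - inverse t, - u * inverse t:]"
  have "x = j t * (1 + x ^ 2) ^ 2 * (1 + j u * x)"
    unfolding j_t j_u x_def by (subst w) (simp only: l_simps)
  then have "poly (map_poly j p) x = 0"
    by (simp add: p_def map_poly_pCons j_simps algebra_simps eval_nat_numeral)
  moreover have "to_laurent f = poly (map_poly j q) x"
  proof -
    have "j t * (1 + to_laurent f) = x - x ^ 3 - j u * x ^ 4"
      unfolding j_t j_u x_def by (simp only: l_simps(1-8)[symmetric] f)
    then have "to_laurent f = inverse (j t) * (x - x ^ 3 - j u * x ^ 4) - 1"
      using t by (simp add: j_simps field_simps)
    then show ?thesis
      by (simp add: q_def map_poly_pCons j_simps algebra_simps eval_nat_numeral)
  qed
  moreover have "p \<noteq> 0" using t by (simp add: p_def)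
  ultimately obtain r where r: "r \<noteq> 0" "poly (map_poly j r) (to_laurent f) = 0"
    using algebraic_polynomial_value[OF j] by blast
  have "coeff (map_poly j r) (degree r) \<noteq> 0"
    using r(1) by (simp add: coeff_map_poly j_simps)
  then have "map_poly j r \<noteq> 0" by auto
  moreover have "coeff (map_poly j r) i \<in> Q_t_u" for i
    by (simp add: coeff_map_poly j_simps j_range)
  ultimately show ?thesis using r(2) unfolding algebraic_over_def by blast
qed

text \<open>This form is what squaring \<open>w * (1 - u * t * X ^ 2) = t * X ^ 2\<close> gives when
  \<open>w ^ 2 = X - 1\<close>.\<close>

lemma X_equation_iff:
  "X_equation X \<longleftrightarrow> (X - 1) * (1 - u_var * t_var * X ^ 2) ^ 2 = t_var ^ 2 * X ^ 4"
proof -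
  have "u ^ 2 * t ^ 2 * X ^ 5 - t ^ 2 * (1 + u ^ 2) * X ^ 4 - 2 * u * t * X ^ 3
      + 2 * u * t * X ^ 2 + X - 1 = (X - 1) * (1 - u * t * X ^ 2) ^ 2 - t ^ 2 * X ^ 4"
    for t u :: series
    by (simp add: algebra_simps eval_nat_numeral)
  then show ?thesis by (simp add: X_equation_def)
qed

text \<open>The difference of the two equations factors as \<open>(X - Y) * (1 + K)\<close>, where
  \<open>K\<close> is a multiple of \<open>t\<close>, so \<open>1 + K\<close> has constant term
  1.\<close>

lemma X_equation_unique:
  assumes "X_equation X" "X_equation Y"
  shows "X = Y"
proof -
  define t u where "t = t_var" and "u = u_var"
  define K where "K = t * (u ^ 2 * t * (X ^ 4 + X ^ 3 * Y + X ^ 2 * Y ^ 2 + X * Y ^ 3 + Y ^ 4)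
    - t * (1 + u ^ 2) * (X ^ 3 + X ^ 2 * Y + X * Y ^ 2 + Y ^ 3)
    - 2 * u * (X ^ 2 + X * Y + Y ^ 2) + 2 * u * (X + Y))"
  define p where "p Z = u ^ 2 * t ^ 2 * Z ^ 5 - t ^ 2 * (1 + u ^ 2) * Z ^ 4 - 2 * u * t * Z ^ 3
      + 2 * u * t * Z ^ 2 + Z - 1" for Z :: series
  have "p X = 0" "p Y = 0"
    using assms by (simp_all add: X_equation_def p_def t_def u_def)
  moreover have "p X - p Y = (X - Y) * (1 + K)"
    unfolding p_def K_def by (simp add: algebra_simps eval_nat_numeral)
  ultimately have "(X - Y) * (1 + K) = 0" by simp
  moreover have "(1 + K) $ 0 = 1" by (simp add: K_def t_def t_var_def)
  then have "1 + K \<noteq> 0" by (metis fps_zero_nth zero_neq_one)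
  ultimately show ?thesis by simp
qed

text \<open>\<open>e1\<close> is multiplied by \<open>u * t * x ^ 2 - 1\<close> because
  \<open>e2\<close> turns \<open>w * (u * t * x ^ 2 - 1)\<close> into \<open>- t * x ^ 2\<close>;
  then \<open>w\<close> occurs only as \<open>w ^ 2 = x - 1\<close>.\<close>

lemma rational_expression:
  fixes t u w x g :: "'a::idom"
  assumes x: "x - 1 = w ^ 2"
    and e1: "x * t ^ 2 * g = 2 * t * x * w + w ^ 2 * (u * t * x - 1)"
    and e2: "w = t * x ^ 2 * (1 + u * w)"
  shows "(g - 1) * (t ^ 2 * x * (u * t * x ^ 2 - 1)) =
    u ^ 2 * t ^ 2 * x ^ 4 - t * (u ^ 2 * t + u * t ^ 2 + u + 2 * t) * x ^ 3
      + (1 + u * t + t ^ 2) * x - 1"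
proof -
  have "(g - 1) * (t ^ 2 * x * (u * t * x ^ 2 - 1)) =
    u ^ 2 * t ^ 2 * x ^ 4 - t * (u ^ 2 * t + u * t ^ 2 + u + 2 * t) * x ^ 3
      + (1 + u * t + t ^ 2) * x - 1
      + (u * t * x ^ 2 - 1) * (x * t ^ 2 * g - (2 * t * x * w + w ^ 2 * (u * t * x - 1)))
      + 2 * t * x * (t * x ^ 2 * (1 + u * w) - w)
      + (w ^ 2 - (x - 1)) * (u * t * x - 1) * (u * t * x ^ 2 - 1)"
    by (simp add: algebra_simps eval_nat_numeral)
  then show ?thesis unfolding e1 x e2[symmetric] by simp
qed

theorem theorem4p7:
  shows "(\<forall>n P Q. (P, Q) \<in> motzkin_intervals n \<longrightarrow> diag_steps P = diag_steps Q) \<and>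
    algebraic_over Q_t_u (to_laurent F1) \<and>
    (\<exists>!X. X_equation X) \<and>
    (\<forall>X. X_equation X \<longrightarrow>
      (let t = t_var; u = u_var in
        to_laurent F1 =
          to_laurent (u^2 * t^2 * X^4 - t * (u^2 * t + u * t^2 + u + 2 * t) * X^3
                      + (1 + u * t + t^2) * X - 1)
          / to_laurent (t^2 * X * (u * t * X^2 - 1))))"
proof -
  obtain w x where x: "x - 1 = w ^ 2"
    and e1: "x * t_var ^ 2 * (1 + F1) = 2 * t_var * x * w + w ^ 2 * (u_var * t_var * x - 1)"
    and e2: "w = t_var * x ^ 2 * (1 + u_var * w)"
    and e3: "t_var * (1 + F1) = w - w ^ 3 - u_var * w ^ 4"
    by (rule parametrization)
  have "w * (1 - u_var * t_var * x ^ 2) = t_var * x ^ 2"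
    using e2 by (simp add: algebra_simps)
  then have "(w * (1 - u_var * t_var * x ^ 2)) ^ 2 = (t_var * x ^ 2) ^ 2" by simp
  then have X: "X_equation x"
    unfolding X_equation_iff x by (simp add: power_mult_distrib flip: power_mult)
  have "x = 1 + w ^ 2" using x by (simp add: algebra_simps)
  then have "algebraic_over Q_t_u (to_laurent F1)"
    using algebraic_over_Q_t_u[OF _ e3] e2 by simp
  moreover have "\<forall>n P Q. (P, Q) \<in> motzkin_intervals n \<longrightarrow> diag_steps P = diag_steps Q"
    using motzkin_intervals_subset by (fastforce simp: le_pairs_def diag_steps_def dest: first_return_le_count_D)
  moreover have "\<exists>!X. X_equation X" using X X_equation_unique by blast
  moreover have "let t = t_var; u = u_var in
        to_laurent F1 =
          to_laurent (u^2 * t^2 * Y^4 - t * (u^2 * t + u * t^2 + u + 2 * t) * Y^3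
                      + (1 + u * t + t^2) * Y - 1)
          / to_laurent (t^2 * Y * (u * t * Y^2 - 1))" if "X_equation Y" for Y
  proof -
    have Y: "Y = x" using that X by (rule X_equation_unique)
    have "x \<noteq> 0"
      using X unfolding X_equation_iff by auto
    moreover have "(u_var * t_var * x ^ 2 - 1) $ 0 = - 1" by (simp add: t_var_def)
    then have "u_var * t_var * x ^ 2 - 1 \<noteq> 0" by (metis fps_zero_nth neg_equal_0_iff_equal zero_neq_one)
    moreover have "t_var \<noteq> 0" by (simp add: t_var_def)
    ultimately have "to_laurent (t_var ^ 2 * x * (u_var * t_var * x ^ 2 - 1)) \<noteq> 0"
      by (simp add: ring_embedding_simps(8)[OF ring_embedding_to_laurent])
    then show ?thesis
      using arg_cong[OF rational_expression[OF x e1 e2], of to_laurent]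
      by (simp add: Y Let_def eq_divide_eq ring_embedding_simps(3)[OF ring_embedding_to_laurent])
  qed
  ultimately show ?thesis by blast
qed

end
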